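(* Let $(X(t))$ be a Markov chain on a countable set $E$ with substochastic transition matrix $P=(p(x,y))_{x,y\in E}$, irreducible and transient on $E$. Assume that $E$ is a subset of a group $(\mathcal E,\star)$, and let $u\in E$ be such that $E\star u\subset E$ and $p(x\star u,y\star u)\ge p(x,y)$ for all $x,y\in E$. Suppose that the hitting probabilities of $(X(t))$ are slowly varying along $u$, i.e. uniformly in $x\in E$, $$\lim_{n\to\infty}\frac1n\log Q(x,x\star u^{\star n})=\lim_{n\to\infty}\frac1n\log Q(x\star u^{\star n},x)=0 .$$ Then every harmonic function $h$ of $(X(t))$ satisfies $$h(y\star u)=h(y)+GA_uh(y),\qquad \forall y\in E.$$
   Context: Irreducible: for all $x,y\in E$ there is $n\ge1$ with $\mathbb P_x(X(n)=y)>0$. The chain is substochastic: with the missing mass $1-\sum_{y\in E}p(x,y)$ it jumps to an additional absorbing state $\vartheta\notin E$. Green function: $G(x,y)=\sum_{t\ge0}\mathbb P_x(X(t)=y)$, $x,y\in E$ (finite by transience); for $\varphi:E\to[0,\infty]$, $G\varphi(x)=\sum_{y\in E}G(x,y)\varphi(y)$ and $P\varphi(x)=\sum_{y\in E}p(x,y)\varphi(y)$. Hitting probabilities: $Q(x,y)=\mathbb P_x(X(t)=y\text{ for some }0<t<+\infty)$. Powers: $u^{\star1}=u$, $u^{\star(n+1)}=u^{\star n}\star u$. A harmonic function is a non-zero function $h:E\to[0,\infty)$ with $Ph=h$. The operator $A_u$ acts on non-negative functions by $A_u\varphi(x)=\sum_{y\in E}a_u(x,y)\varphi(y)$, where $a_u(x,y)=p(x\star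 u,y)-p(x,y\star u^{-1})$ if $y\in E\star u$ and $a_u(x,y)=p(x\star u,y)$ if $y\in E\setminus(E\star u)$. Under the assumptions $a_u(x,y)\ge0$. *)

theory Defs
  imports "HOL-Probability.Probability" "HOL-Algebra.Coset"
begin

definition substochastic :: "'a set \<Rightarrow> ('a \<Rightarrow> 'a \<Rightarrow> real) \<Rightarrow> bool" where
  "substochastic E p \<longleftrightarrow>
     (\<forall>x\<in>E. \<forall>y\<in>E. 0 \<le> p x y) \<and>
     (\<forall>x\<in>E. p x summable_on E \<and> (\<Sum>\<^sub>\<infinity>y\<in>E. p x y) \<le> 1)"

(* The additional absorbing state is None; a point x of E is the state Some x. *)

definition states :: "'a set \<Rightarrow> 'a option set" where
  "states E = insert None (Some ` E)"

definition ext_trans :: "'a set \<Rightarrow> ('a \<Rightarrow> 'a \<Rightarrow> real) \<Rightarrow> 'a option \<Rightarrow> 'a option \<Rightarrow> real" where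
  "ext_trans E p s s' =
     (case s of
        None \<Rightarrow> (if s' = None then 1 else 0)
      | Some x \<Rightarrow> (case s' of None \<Rightarrow> 1 - (\<Sum>\<^sub>\<infinity>y\<in>E. p x y) | Some y \<Rightarrow> p x y))"

(* M x is the law of the chain started at x. The last conjunct is the Markov property, multiplied
   out so that conditioning on null events needs no separate treatment. *)

definition markov_chain ::
    "'a set \<Rightarrow> ('a \<Rightarrow> 'a \<Rightarrow> real) \<Rightarrow> ('a \<Rightarrow> 'w measure) \<Rightarrow> (nat \<Rightarrow> 'w \<Rightarrow> 'a option) \<Rightarrow> bool" where
  "markov_chain E p M X \<longleftrightarrow>
     (\<forall>x\<in>E. prob_space (M x) \<and>
        (\<forall>t. X t \<in> measurable (M x) (count_space (states E))) \<and>
        \<P>(w in M x. X 0 w = Some x) = 1 \<and>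
        (\<forall>t. \<forall>s. (\<forall>i\<le>Suc t. s i \<in> states E) \<longrightarrow>
           \<P>(w in M x. \<forall>i\<le>Suc t. X i w = s i) =
             \<P>(w in M x. \<forall>i\<le>t. X i w = s i) * ext_trans E p (s t) (s (Suc t))))"

definition irreducible_chain ::
    "'a set \<Rightarrow> ('a \<Rightarrow> 'w measure) \<Rightarrow> (nat \<Rightarrow> 'w \<Rightarrow> 'a option) \<Rightarrow> bool" where
  "irreducible_chain E M X \<longleftrightarrow>
     (\<forall>x\<in>E. \<forall>y\<in>E. \<exists>n\<ge>1. \<P>(w in M x. X n w = Some y) > 0)"

definition hitting ::
    "('a \<Rightarrow> 'w measure) \<Rightarrow> (nat \<Rightarrow> 'w \<Rightarrow> 'a option) \<Rightarrow> 'a \<Rightarrow> 'a \<Rightarrow> real" where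
  "hitting M X x y = \<P>(w in M x. \<exists>t>0. X t w = Some y)"

definition transient_chain ::
    "'a set \<Rightarrow> ('a \<Rightarrow> 'w measure) \<Rightarrow> (nat \<Rightarrow> 'w \<Rightarrow> 'a option) \<Rightarrow> bool" where
  "transient_chain E M X \<longleftrightarrow> (\<forall>x\<in>E. hitting M X x x < 1)"

definition green ::
    "('a \<Rightarrow> 'w measure) \<Rightarrow> (nat \<Rightarrow> 'w \<Rightarrow> 'a option) \<Rightarrow> 'a \<Rightarrow> 'a \<Rightarrow> ennreal" where
  "green M X x y = (\<Sum>t. ennreal \<P>(w in M x. X t w = Some y))"

(* Operators act on [0,\<infinity>]-valued functions; the integral against count_space E is the sum over E. *)

definition green_op ::
    "'a set \<Rightarrow> ('a \<Rightarrow> 'w measure) \<Rightarrow> (nat \<Rightarrow> 'w \<Rightarrow> 'a option) \<Rightarrow> ('a \<Rightarrow> ennreal) \<Rightarrow> 'a \<Rightarrow> ennreal" where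
  "green_op E M X \<phi> x = (\<integral>\<^sup>+ y. green M X x y * \<phi> y \<partial>count_space E)"

definition trans_op ::
    "'a set \<Rightarrow> ('a \<Rightarrow> 'a \<Rightarrow> real) \<Rightarrow> ('a \<Rightarrow> ennreal) \<Rightarrow> 'a \<Rightarrow> ennreal" where
  "trans_op E p \<phi> x = (\<integral>\<^sup>+ y. ennreal (p x y) * \<phi> y \<partial>count_space E)"

definition harmonic :: "'a set \<Rightarrow> ('a \<Rightarrow> 'a \<Rightarrow> real) \<Rightarrow> ('a \<Rightarrow> real) \<Rightarrow> bool" where
  "harmonic E p h \<longleftrightarrow>
     (\<forall>x\<in>E. 0 \<le> h x) \<and> (\<exists>x\<in>E. h x \<noteq> 0) \<and>
     (\<forall>x\<in>E. trans_op E p (\<lambda>y. ennreal (h y)) x = ennreal (h x))"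

definition shift_diff ::
    "('a, 'b) monoid_scheme \<Rightarrow> 'a set \<Rightarrow> ('a \<Rightarrow> 'a \<Rightarrow> real) \<Rightarrow> 'a \<Rightarrow> 'a \<Rightarrow> 'a \<Rightarrow> real" where
  "shift_diff G E p u x y =
     (if y \<in> E #>\<^bsub>G\<^esub> u
      then p (x \<otimes>\<^bsub>G\<^esub> u) y - p x (y \<otimes>\<^bsub>G\<^esub> inv\<^bsub>G\<^esub> u)
      else p (x \<otimes>\<^bsub>G\<^esub> u) y)"

(* ennreal truncates negative reals to 0, which is harmless here by shift_diff_nonneg below. *)

definition shift_diff_op ::
    "('a, 'b) monoid_scheme \<Rightarrow> 'a set \<Rightarrow> ('a \<Rightarrow> 'a \<Rightarrow> real) \<Rightarrow> 'a \<Rightarrow> ('a \<Rightarrow> ennreal) \<Rightarrow> 'a \<Rightarrow> ennreal" where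
  "shift_diff_op G E p u \<phi> x = (\<integral>\<^sup>+ y. ennreal (shift_diff G E p u x y) * \<phi> y \<partial>count_space E)"

lemma shift_diff_nonneg:
  assumes "group G" "E \<subseteq> carrier G" "u \<in> E" "E #>\<^bsub>G\<^esub> u \<subseteq> E" "substochastic E p"
    and mono: "\<And>x y. x \<in> E \<Longrightarrow> y \<in> E \<Longrightarrow> p x y \<le> p (x \<otimes>\<^bsub>G\<^esub> u) (y \<otimes>\<^bsub>G\<^esub> u)"
    and "x \<in> E" "y \<in> E"
  shows "0 \<le> shift_diff G E p u x y"
proof (cases "y \<in> E #>\<^bsub>G\<^esub> u")
  case True
  then obtain z where z: "z \<in> E" "y = z \<otimes>\<^bsub>G\<^esub> u"
    by (auto simp: r_coset_def)
  then have "y \<otimes>\<^bsub>G\<^esub> inv\<^bsub>G\<^esub> u = z"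
    using assms(1-3) by (metis group.inv_solve_right' subsetD group.is_monoid monoid.m_closed)
  then show ?thesis
    using True z mono[OF \<open>x \<in> E\<close> z(1)] by (simp add: shift_diff_def)
next
  case False
  have "x \<otimes>\<^bsub>G\<^esub> u \<in> E"
    using assms(4) \<open>x \<in> E\<close> by (auto simp: r_coset_def)
  then show ?thesis
    using False assms(5) \<open>y \<in> E\<close> by (simp add: shift_diff_def substochastic_def)
qed

definition slowly_varying_hitting ::
    "('a, 'b) monoid_scheme \<Rightarrow> 'a set \<Rightarrow> ('a \<Rightarrow> 'w measure) \<Rightarrow> (nat \<Rightarrow> 'w \<Rightarrow> 'a option) \<Rightarrow> 'a \<Rightarrow> bool" where
  "slowly_varying_hitting G E M X u \<longleftrightarrow>
     uniform_limit E (\<lambda>n x. 1 / real n * ln (hitting M X x (x \<otimes>\<^bsub>G\<^esub> u [^]\<^bsub>G\<^esub> n))) (\<lambda>_. 0) sequentially \<and>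
     uniform_limit E (\<lambda>n x. 1 / real n * ln (hitting M X (x \<otimes>\<^bsub>G\<^esub> u [^]\<^bsub>G\<^esub> n) x)) (\<lambda>_. 0) sequentially"

end

theory Submission
  imports Defs
begin

text \<open>Write \<open>T f(x) = f(x \<star> u)\<close>. Monotonicity of \<open>p\<close> along \<open>u\<close> gives \<open>P T \<le> T P\<close> and, for harmonic \<open>h\<close>,
  \<open>T h = P T h + A\<^sub>u h\<close>. Hence \<open>T h = G A\<^sub>u h + U h\<close>, where \<open>U h = lim P^k T h\<close> is harmonic, and one has
  to show \<open>U h = h\<close>. By \<open>P T \<le> T P\<close> potentials stay potentials under \<open>T\<close>, so \<open>U^n h\<close> is the harmonic
  part of \<open>T^n h\<close>. Since \<open>Q(x,y) h(y) \<le> h(x)\<close>, slow variation yields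
  \<open>exp(-\<epsilon>n) \<le> U^n \<le> exp(\<epsilon>n)\<close> for large \<open>n\<close>, uniformly on the cone of harmonic functions.

  In a Martin representation \<open>U\<close> would act as multiplication by a function, which these bounds force
  to be \<open>1\<close>. Instead of representing harmonic functions, one considers for \<open>0 \<le> V \<le> 1\<close> the numbers
  \<open>c i j = V^i (1 - V)^j f(x)\<close>: they are nonnegative and satisfy \<open>c i j = c (i+1) j + c i (j+1)\<close>, so they
  are moments of Hausdorff type, hence log-convex in each index, and this suffices to conclude.\<close>

subsection \<open>Nonnegative Pascal arrays\<close>

text \<open>Unfolding the recurrence \<open>N\<close> times sums over lattice paths out of
  \<open>(i, j)\<close>; \<open>N choose k\<close> counts those with \<open>k\<close> steps in the
  second index.\<close>

lemma pascal_array_expand: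
  fixes c :: "nat \<Rightarrow> nat \<Rightarrow> real"
  assumes "\<And>i j. c i j = c (Suc i) j + c i (Suc j)"
  shows "c i j = (\<Sum>k\<le>N. real (N choose k) * c (i + (N - k)) (j + k))"
proof (induction N arbitrary: i j)
  case (Suc N)
  have "(\<Sum>k\<le>Suc N. real (Suc N choose k) * c (i + (Suc N - k)) (j + k))
      = c (i + Suc N) j + (\<Sum>k\<le>N. real (Suc N choose Suc k) * c (i + (N - k)) (j + Suc k))"
    by (subst sum.atMost_Suc_shift) simp
  also have "\<dots> = (c (i + Suc N) j + (\<Sum>k\<le>N. real (N choose Suc k) * c (i + (N - k)) (j + Suc k)))
       + (\<Sum>k\<le>N. real (N choose k) * c (i + (N - k)) (Suc j + k))"
    by (simp add: algebra_simps sum.distrib)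
  also have "c (i + Suc N) j + (\<Sum>k\<le>N. real (N choose Suc k) * c (i + (N - k)) (j + Suc k))
      = (\<Sum>k\<le>Suc N. real (N choose k) * c (i + (Suc N - k)) (j + k))"
    by (subst sum.atMost_Suc_shift) simp
  \<comment> \<open>The top term drops out because \<open>N choose Suc N = 0\<close>.\<close>
  also have "\<dots> = (\<Sum>k\<le>N. real (N choose k) * c (Suc i + (N - k)) (j + k))"
    by (simp add: Suc_diff_le)
  finally show ?case
    using assms[of i j] Suc.IH[of "Suc i" j] Suc.IH[of i "Suc j"] by simp
qed simp

text \<open>One term of the expansion of \<open>c 0 0\<close> at depth \<open>n + k\<close>, all of
  whose terms are nonnegative.\<close>

lemma pascal_array_binomial_le:
  fixes c :: "nat \<Rightarrow> nat \<Rightarrow> real"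
  assumes "\<And>i j. c i j = c (Suc i) j + c i (Suc j)" and nonneg: "\<And>i j. 0 \<le> c i j"
  shows "real ((n + k) choose k) * c n k \<le> c 0 0"
proof -
  have "real ((n + k) choose k) * c (0 + (n + k - k)) (0 + k) \<le>
      (\<Sum>j\<le>n + k. real ((n + k) choose j) * c (0 + (n + k - j)) (0 + j))"
    by (rule member_le_sum) (auto intro!: mult_nonneg_nonneg nonneg)
  then show ?thesis
    using pascal_array_expand[of c 0 0 "n + k", OF assms(1)] by simp
qed

text \<open>With weights \<open>w k = (N choose k) * c (N - k) k\<close>, the row sum and the first two factorial
  moments of \<open>N - k\<close> are multiples of \<open>c 0 0\<close>, \<open>c 1 0\<close>, \<open>c 2 0\<close>; nonnegativity of the variance gives
  the inequality up to an error of order \<open>1 / N\<close>.\<close>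

lemma pascal_array_square_le:
  fixes c :: "nat \<Rightarrow> nat \<Rightarrow> real"
  assumes rec: "\<And>i j. c i j = c (Suc i) j + c i (Suc j)" and nonneg: "\<And>i j. 0 \<le> c i j"
  shows "(c 1 0)\<^sup>2 \<le> c 0 0 * c 2 0"
proof -
  \<comment> \<open>For \<open>N = Suc m\<close> this is the second moment of \<open>N - k\<close>
    about \<open>r * N\<close>, divided by \<open>N\<close> squared. The case \<open>N = 1\<close>
    is separate because the second factorial moment lowers the depth by two.\<close>
  have quad: "0 \<le> c 2 0 - 2 * r * c 1 0 + r\<^sup>2 * c 0 0 + (c 1 0 - c 2 0) * inverse (real (Suc m))" for r m
  proof (cases m)
    case 0
    have "r\<^sup>2 * c 0 0 - 2 * r * c 1 0 + c 1 0 = r\<^sup>2 * c 0 1 + (r - 1)\<^sup>2 * c 1 0"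
      using rec[of 0 0] by (simp add: power2_eq_square algebra_simps)
    then have "0 \<le> r\<^sup>2 * c 0 0 - 2 * r * c 1 0 + c 1 0"
      using nonneg by simp
    then show ?thesis using 0 by simp
  next
    case (Suc n)
    define N where "N = Suc (Suc n)"
    define w where "w k = real (N choose k) * c (N - k) k" for k
    have w0: "(\<Sum>k\<le>N. w k) = c 0 0"
      using pascal_array_expand[of c 0 0 N, OF rec] by (simp add: w_def)
    \<comment> \<open>The term \<open>k = N\<close> vanishes; absorption of \<open>N - k\<close>
      into the binomial coefficient turns the rest into \<open>N\<close> times the expansion of
      \<open>c 1 0\<close> at depth \<open>N - 1\<close>.\<close>
    have "(\<Sum>k\<le>N. w k * real (N - k)) = (\<Sum>k\<le>Suc n. w k * real (N - k))"
      by (simp add: N_def)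
    also have "\<dots> = (\<Sum>k\<le>Suc n. real N * (real (Suc n choose k) * c (1 + (Suc n - k)) (0 + k)))"
    proof (rule sum.cong)
      fix k assume "k \<in> {..Suc n}"
      then have k: "k \<le> Suc n" by simp
      have "real (N - k) * real (N choose k) = real N * real (Suc n choose k)"
        using binomial_absorb_comp[of N k] unfolding N_def diff_Suc_1 by (metis of_nat_mult)
      moreover have "1 + (Suc n - k) = N - k" using k by (simp add: N_def)
      ultimately show "w k * real (N - k) = real N * (real (Suc n choose k) * c (1 + (Suc n - k)) (0 + k))"
        by (simp add: w_def mult_ac) 
    qed simp
    finally have w1: "(\<Sum>k\<le>N. w k * real (N - k)) = real N * c 1 0"
      using pascal_array_expand[of c 1 0 "Suc n", OF rec] by (simp only: sum_distrib_left)
    \<comment> \<open>Here \<open>k = N\<close> and \<open>k = N - 1\<close> both drop out, and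
      absorbing twice leads to the expansion of \<open>c 2 0\<close> at depth
      \<open>N - 2\<close>.\<close>
    have "(\<Sum>k\<le>N. w k * (real (N - k) * (real (N - k) - 1))) = (\<Sum>k\<le>n. w k * (real (N - k) * (real (N - k) - 1)))"
      by (simp add: N_def)
    also have "\<dots> = (\<Sum>k\<le>n. real N * real (Suc n) * (real (n choose k) * c (2 + (n - k)) (0 + k)))"
    proof (rule sum.cong)
      fix k assume "k \<in> {..n}"
      then have k: "k \<le> n" by simp
      have 1: "real (N - k) * real (N choose k) = real N * real (Suc n choose k)"
        using binomial_absorb_comp[of N k] unfolding N_def diff_Suc_1 by (metis of_nat_mult)
      have 2: "real (Suc n - k) * real (Suc n choose k) = real (Suc n) * real (n choose k)"
        using binomial_absorb_comp[of "Suc n" k] unfolding diff_Suc_1 by (metis of_nat_mult)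
      have 3: "2 + (n - k) = N - k" "real (N - k) - 1 = real (Suc n - k)"
        using k by (simp_all add: N_def of_nat_diff)
      have "w k * (real (N - k) * (real (N - k) - 1))
        = (real (N - k) * real (N choose k)) * real (Suc n - k) * c (N - k) k"
        using 3 by (simp add: w_def mult_ac)
      also have "\<dots> = real N * (real (Suc n - k) * real (Suc n choose k)) * c (N - k) k"
        unfolding 1 by (simp only: mult_ac)
      also have "\<dots> = real N * real (Suc n) * (real (n choose k) * c (2 + (n - k)) (0 + k))"
        unfolding 2 3 by (simp only: mult_ac add_0)
      finally show "w k * (real (N - k) * (real (N - k) - 1))
        = real N * real (Suc n) * (real (n choose k) * c (2 + (n - k)) (0 + k))" .
    qed simp
    finally have w2: "(\<Sum>k\<le>N. w k * (real (N - k) * (real (N - k) - 1))) = real N * real (Suc n) * c 2 0"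
      using pascal_array_expand[of c 2 0 n, OF rec] by (simp only: sum_distrib_left)
    have "0 \<le> (\<Sum>k\<le>N. w k * (real (N - k) - r * real N)\<^sup>2)"
      by (intro sum_nonneg mult_nonneg_nonneg) (auto simp: w_def intro!: mult_nonneg_nonneg nonneg)
    also have "\<dots> = (\<Sum>k\<le>N. w k * (real (N - k) * (real (N - k) - 1)) + (1 - 2 * r * real N) * (w k * real (N - k))
        + (r * real N)\<^sup>2 * w k)"
      by (intro sum.cong refl) (simp add: power2_eq_square algebra_simps)
    also have "\<dots> = real N * real (Suc n) * c 2 0 + (1 - 2 * r * real N) * (real N * c 1 0) + (r * real N)\<^sup>2 * c 0 0"
      by (simp only: sum.distrib w0 w1 w2 flip: sum_distrib_left)
    also have "\<dots> = (real N)\<^sup>2 * (c 2 0 - 2 * r * c 1 0 + r\<^sup>2 * c 0 0 + (c 1 0 - c 2 0) * inverse (real (Suc m)))"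
      using Suc by (simp add: N_def power2_eq_square field_simps)
    finally show ?thesis by (simp add: N_def zero_le_mult_iff)
  qed
  have quad: "0 \<le> c 2 0 - 2 * r * c 1 0 + r\<^sup>2 * c 0 0" for r
  proof (rule LIMSEQ_le_const)
    show "(\<lambda>m. c 2 0 - 2 * r * c 1 0 + r\<^sup>2 * c 0 0 + (c 1 0 - c 2 0) * inverse (real (Suc m)))
        \<longlonglongrightarrow> c 2 0 - 2 * r * c 1 0 + r\<^sup>2 * c 0 0"
      using tendsto_add[OF tendsto_const tendsto_mult[OF tendsto_const LIMSEQ_inverse_real_of_nat],
        of "c 2 0 - 2 * r * c 1 0 + r\<^sup>2 * c 0 0" "c 1 0 - c 2 0"] by simp
  qed (use quad in blast)
  show ?thesis
  proof (cases "c 0 0 = 0")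
    case True
    then have "c 1 0 = 0" using rec[of 0 0] nonneg[of 1 0] nonneg[of 0 1] by simp
    then show ?thesis using True by simp
  next
    case False
    then have pos: "c 0 0 > 0" using nonneg[of 0 0] by simp
    \<comment> \<open>The quadratic in \<open>r\<close> is evaluated at its minimiser
      \<open>c 1 0 / c 0 0\<close>.\<close>
    have "0 \<le> c 0 0 * (c 2 0 - 2 * (c 1 0 / c 0 0) * c 1 0 + (c 1 0 / c 0 0)\<^sup>2 * c 0 0)"
      using quad[of "c 1 0 / c 0 0"] pos by (intro mult_nonneg_nonneg) simp_all
    also have "\<dots> = c 0 0 * c 2 0 - (c 1 0)\<^sup>2"
      using pos by (simp add: field_simps power2_eq_square)
    finally show ?thesis by simp
  qed
qed

text \<open>The square inequality for the array shifted by \<open>n\<close> makes the sequence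
  \<open>c n 0\<close> log-convex. Its successive ratios therefore never fall below the first
  one.\<close>

lemma pascal_array_power_le:
  fixes c :: "nat \<Rightarrow> nat \<Rightarrow> real"
  assumes rec: "\<And>i j. c i j = c (Suc i) j + c i (Suc j)" and nonneg: "\<And>i j. 0 \<le> c i j"
    and pos: "c 0 0 > 0"
  shows "(c 1 0 / c 0 0) ^ n * c 0 0 \<le> c n 0"
proof (cases "c 1 0 = 0")
  case True
  then show ?thesis using nonneg pos by (cases n) auto
next
  case False
  then have q: "c 1 0 / c 0 0 > 0" using pos nonneg[of 1 0] by simp
  \<comment> \<open>Positivity is carried through the induction because the factor
    \<open>c n 0\<close> has to be cancelled.\<close>
  have "c n 0 > 0 \<and> c 1 0 / c 0 0 * c n 0 \<le> c (Suc n) 0" for n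
  proof (induction n)
    case (Suc n)
    have "c (n + i) j = c (n + Suc i) j + c (n + i) (Suc j)" for i j
      using rec[of "n + i" j] by simp
    from pascal_array_square_le[of "\<lambda>i. c (n + i)", OF this nonneg]
    have "(c (Suc n) 0)\<^sup>2 \<le> c n 0 * c (Suc (Suc n)) 0" by simp
    moreover have p: "0 < c (Suc n) 0" using Suc q by (smt (verit) mult_pos_pos)
    moreover have "c (Suc n) 0 * (c 1 0 / c 0 0 * c n 0) \<le> c (Suc n) 0 * c (Suc n) 0"
      using Suc p by (intro mult_left_mono) auto
    ultimately have "c n 0 * (c 1 0 / c 0 0 * c (Suc n) 0) \<le> c n 0 * c (Suc (Suc n)) 0"
      by (simp add: power2_eq_square mult_ac)
    then show ?case using p Suc mult_left_le_imp_le by blast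
  qed (use pos in simp)
  then have step: "c 1 0 / c 0 0 * c n 0 \<le> c (Suc n) 0" for n by blast
  show ?thesis
  proof (induction n)
    case (Suc n)
    have "(c 1 0 / c 0 0) ^ Suc n * c 0 0 = c 1 0 / c 0 0 * ((c 1 0 / c 0 0) ^ n * c 0 0)" by simp
    also have "\<dots> \<le> c 1 0 / c 0 0 * c n 0" using Suc q by (intro mult_left_mono) auto
    finally show ?case using step[of n] by simp
  qed simp
qed

text \<open>The geometric lower bound compares \<open>(c 1 0 / c 0 0) ^ n\<close> with
  \<open>b ^ n\<close>, so a bound at a single positive exponent already controls the first
  ratio.\<close>

lemma pascal_array_growth_le:
  fixes c :: "nat \<Rightarrow> nat \<Rightarrow> real"
  assumes rec: "\<And>i j. c i j = c (Suc i) j + c i (Suc j)" and nonneg: "\<And>i j. 0 \<le> c i j"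
    and "0 \<le> b" and growth: "\<And>n. n \<ge> N \<Longrightarrow> c n 0 \<le> b ^ n * c 0 0"
  shows "c 1 0 \<le> b * c 0 0"
proof (cases "c 0 0 = 0")
  case True
  then show ?thesis using rec[of 0 0] nonneg[of 1 0] nonneg[of 0 1] by simp
next
  case False
  then have pos: "c 0 0 > 0" using nonneg[of 0 0] by simp
  \<comment> \<open>The exponent \<open>Suc N\<close> is positive, so the root can be taken.\<close>
  have "(c 1 0 / c 0 0) ^ Suc N * c 0 0 \<le> b ^ Suc N * c 0 0"
    using pascal_array_power_le[OF rec nonneg pos, of "Suc N"] growth[of "Suc N"] by simp
  then have "c 1 0 / c 0 0 \<le> b"
    using pos \<open>0 \<le> b\<close> by (meson mult_le_cancel_right_pos power_le_imp_le_base)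
  then show ?thesis using pos by (simp add: field_simps)
qed

text \<open>If \<open>c 0 1 = q * c 0 0\<close> then \<open>c 0 k \<ge> q ^ k * c 0 0\<close>. In the entry \<open>(L * k, k)\<close> the binomial
  coefficient is at least \<open>L ^ k\<close>, while the decay costs only \<open>exp k\<close> if the rate is \<open>1 / L\<close>;
  hence \<open>L * q \<le> exp 1\<close> for every \<open>L\<close>.\<close>

lemma pascal_array_slow_decay_eq_0:
  fixes c :: "nat \<Rightarrow> nat \<Rightarrow> real"
  assumes rec: "\<And>i j. c i j = c (Suc i) j + c i (Suc j)" and nonneg: "\<And>i j. 0 \<le> c i j"
    and decay: "\<And>\<epsilon>. \<epsilon> > 0 \<Longrightarrow> \<exists>N. \<forall>n\<ge>N. \<forall>j. c 0 j \<le> exp (\<epsilon> * real n) * c n j"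
  shows "c 0 1 = 0"
proof (rule ccontr)
  assume nz: "c 0 1 \<noteq> 0"
  then have pos1: "c 0 1 > 0" using nonneg[of 0 1] by simp
  then have pos: "c 0 0 > 0" using rec[of 0 0] nonneg[of 1 0] by simp
  define q where "q = c 0 1 / c 0 0"
  have q: "q > 0" using pos pos1 by (simp add: q_def)
  have "real L * q \<le> exp 1" if L: "L > 0" for L
  proof -
    obtain N where N: "\<And>n j. n \<ge> N \<Longrightarrow> c 0 j \<le> exp (1 / real L * real n) * c n j"
      using decay[of "1 / real L"] L by auto
    \<comment> \<open>This makes \<open>k\<close> positive, for the final \<open>k\<close>-th root,
      and gives \<open>L * k \<ge> N\<close>, for the decay bound.\<close>
    define k where "k = Suc N"
    have "real L ^ k \<le> real ((L * k + k) choose k)"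
    proof -
      have "real L ^ k \<le> (real (L * k + k) / real k) ^ k"
        by (intro power_mono) (auto simp: k_def field_simps)
      also have "\<dots> \<le> real ((L * k + k) choose k)"
        using binomial_ge_n_over_k_pow_k[of k "L * k + k"] by simp
      finally show ?thesis .
    qed
    then have "real L ^ k * c (L * k) k \<le> c 0 0"
      using pascal_array_binomial_le[of c "L * k" k, OF rec nonneg]
      using mult_right_mono[OF _ nonneg[of "L * k" k]] order_trans by blast
    moreover have "c 0 k \<le> exp (real k) * c (L * k) k"
    proof -
      have "1 * N \<le> L * k" using L by (intro mult_le_mono) (auto simp: k_def)
      then show ?thesis using N[of "L * k" k] L by simp
    qed
    moreover have "q ^ k * c 0 0 \<le> c 0 k"
    proof -
      \<comment> \<open>The power bound is applied to the transposed array.\<close>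
      have "c j i = c j (Suc i) + c (Suc j) i" for i j using rec[of j i] by simp
      from pascal_array_power_le[of "\<lambda>i j. c j i" k, OF this nonneg pos]
      show ?thesis by (simp add: q_def)
    qed
    ultimately have "real L ^ k * (q ^ k * c 0 0) \<le> exp (real k) * c 0 0"
      by (smt (verit) exp_ge_zero mult.left_commute mult_left_mono of_nat_0_le_iff zero_le_power)
    then have "(real L * q) ^ k \<le> exp 1 ^ k"
      using pos by (simp add: power_mult_distrib exp_of_nat_mult[of k 1, simplified] flip: mult.assoc)
    then show ?thesis
      by (rule power_le_imp_le_base[of _ N, folded k_def]) simp
  qed
  moreover obtain L where "real L > exp 1 / q" using reals_Archimedean2 by blast
  ultimately show False
    using q by (smt (verit) divide_pos_pos exp_gt_zero mult.commute of_nat_0_less_iff pos_divide_less_eq)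
qed

subsection \<open>Positive operators of subexponential growth\<close>

text \<open>Closure of \<open>H\<close> under ordered differences lets \<open>I - V\<close> act on
  \<open>H\<close>; finiteness of the values makes subtraction invert addition.\<close>

locale positive_contraction =
  fixes H :: "('a \<Rightarrow> ennreal) set" and V :: "('a \<Rightarrow> ennreal) \<Rightarrow> 'a \<Rightarrow> ennreal"
  assumes finite_valued: "f \<in> H \<Longrightarrow> f x < \<top>"
    and diff_mem: "f \<in> H \<Longrightarrow> g \<in> H \<Longrightarrow> (\<And>x. g x \<le> f x) \<Longrightarrow> (\<lambda>x. f x - g x) \<in> H"
    and V_mem: "f \<in> H \<Longrightarrow> V f \<in> H"
    and V_add: "f \<in> H \<Longrightarrow> g \<in> H \<Longrightarrow> V (\<lambda>x. f x + g x) = (\<lambda>x. V f x + V g x)"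
    and V_le: "f \<in> H \<Longrightarrow> V f x \<le> f x"
begin

definition defect :: "('a \<Rightarrow> ennreal) \<Rightarrow> 'a \<Rightarrow> ennreal" where
  "defect f = (\<lambda>x. f x - V f x)"

text \<open>The numbers \<open>V^i (I - V)^j f(x)\<close>, with \<open>defect\<close> in the role of
  \<open>I - V\<close>. For \<open>f\<close> in \<open>H\<close> they are finite, so the passage to
  reals loses nothing.\<close>

definition array :: "('a \<Rightarrow> ennreal) \<Rightarrow> 'a \<Rightarrow> nat \<Rightarrow> nat \<Rightarrow> real" where
  "array f x i j = enn2real ((V ^^ i) ((defect ^^ j) f) x)"

lemma V_power_mem: "f \<in> H \<Longrightarrow> (V ^^ n) f \<in> H"
  by (induction n) (auto intro: V_mem)

lemma defect_power_mem: "f \<in> H \<Longrightarrow> (defect ^^ n) f \<in> H"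
  by (induction n) (auto simp: defect_def intro!: diff_mem V_mem V_le)

lemma V_power_add:
  "f \<in> H \<Longrightarrow> g \<in> H \<Longrightarrow> (V ^^ n) (\<lambda>x. f x + g x) = (\<lambda>x. (V ^^ n) f x + (V ^^ n) g x)"
  by (induction n) (auto simp: V_add V_power_mem)

lemma V_add_defect: "f \<in> H \<Longrightarrow> f = (\<lambda>x. V f x + defect f x)"
  unfolding defect_def by (metis V_le add.commute diff_add_cancel_ennreal)

lemma array_nonneg: "0 \<le> array f x i j"
  by (simp add: array_def)

text \<open>With \<open>V ^^ i\<close> outermost, this is additivity of \<open>V ^^ i\<close> on the
  splitting \<open>g = V g + defect g\<close>, where \<open>g = (defect ^^ j) f\<close>.\<close>

lemma array_rec:
  assumes "f \<in> H"
  shows "array f x i j = array f x (Suc i) j + array f x i (Suc j)"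
proof -
  define g where "g = (defect ^^ j) f"
  have g: "g \<in> H" "V g \<in> H" "defect g \<in> H"
    using defect_power_mem[OF assms, of j] defect_power_mem[OF assms, of "Suc j"]
    by (simp_all add: g_def V_mem)
  have "(V ^^ i) g = (\<lambda>x. (V ^^ i) (V g) x + (V ^^ i) (defect g) x)"
    using V_power_add[OF g(2,3), of i] V_add_defect[OF g(1)] by simp
  moreover have array_Suc: "array f x (Suc i) j = enn2real ((V ^^ i) (V g) x)"
      "array f x i (Suc j) = enn2real ((V ^^ i) (defect g) x)"
    by (simp_all add: array_def g_def funpow_swap1)
  ultimately show ?thesis
    using finite_valued[OF V_power_mem[OF g(2)], of i x] finite_valued[OF V_power_mem[OF g(3)], of i x]
    unfolding array_Suc by (simp add: array_def enn2real_plus flip: g_def)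
qed

text \<open>The entries with \<open>j = 0\<close> are the iterates \<open>V^n f(x)\<close>, so
  log-convexity turns their asymptotic growth rate into a bound for one step.\<close>

lemma V_le_of_growth:
  assumes f: "f \<in> H" and "0 \<le> b"
    and growth: "\<And>n. n \<ge> N \<Longrightarrow> (V ^^ n) f x \<le> ennreal (b ^ n) * f x"
  shows "V f x \<le> ennreal b * f x"
proof -
  have "array f x n 0 \<le> b ^ n * array f x 0 0" if "n \<ge> N" for n
  proof -
    have "enn2real ((V ^^ n) f x) \<le> enn2real (ennreal (b ^ n) * f x)"
      using growth[OF that] finite_valued[OF f] by (intro enn2real_mono) (auto simp: ennreal_mult_less_top)
    then show ?thesis using \<open>0 \<le> b\<close> by (simp add: array_def enn2real_mult)
  qed
  from pascal_array_growth_le[of "array f x", OF array_rec[OF f] array_nonneg \<open>0 \<le> b\<close> this]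
  have "enn2real (V f x) \<le> b * enn2real (f x)" by (simp add: array_def)
  then have "ennreal (enn2real (V f x)) \<le> ennreal b * ennreal (enn2real (f x))"
    using \<open>0 \<le> b\<close> by (simp add: ennreal_leI flip: ennreal_mult)
  then show ?thesis using finite_valued[OF f] finite_valued[OF V_mem[OF f]] by simp
qed

text \<open>The decay bound is used for all functions \<open>(defect ^^ j) f\<close> at once, whence
  its uniformity over \<open>H\<close>. The slow-decay lemma then annihilates
  \<open>defect f x\<close>.\<close>

lemma V_eq_of_slow_decay:
  assumes f: "f \<in> H"
    and decay: "\<And>\<epsilon>. \<epsilon> > 0 \<Longrightarrow>
      \<exists>N. \<forall>n\<ge>N. \<forall>g\<in>H. g x \<le> ennreal (exp (\<epsilon> * real n)) * (V ^^ n) g x"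
  shows "V f x = f x"
proof -
  have "\<exists>N. \<forall>n\<ge>N. \<forall>j. array f x 0 j \<le> exp (\<epsilon> * real n) * array f x n j" if \<epsilon>: "\<epsilon> > 0" for \<epsilon>
  proof -
    obtain N where N: "\<And>n g. n \<ge> N \<Longrightarrow> g \<in> H \<Longrightarrow> g x \<le> ennreal (exp (\<epsilon> * real n)) * (V ^^ n) g x"
      using decay[OF \<epsilon>] by blast
    have "array f x 0 j \<le> exp (\<epsilon> * real n) * array f x n j" if "n \<ge> N" for n j
    proof -
      define g where "g = (defect ^^ j) f"
      have g: "g \<in> H" using defect_power_mem[OF f] by (simp add: g_def)
      have "enn2real (g x) \<le> enn2real (ennreal (exp (\<epsilon> * real n)) * (V ^^ n) g x)"
        using N[OF that g] finite_valued[OF V_power_mem[OF g]]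
        by (intro enn2real_mono) (auto simp: ennreal_mult_less_top)
      then show ?thesis by (simp add: array_def enn2real_mult flip: g_def)
    qed
    then show ?thesis by blast
  qed
  from pascal_array_slow_decay_eq_0[of "array f x", OF array_rec[OF f] array_nonneg this]
  have "enn2real (defect f x) = 0" by (simp add: array_def)
  then have "defect f x = 0"
    using finite_valued[OF defect_power_mem[OF f, of 1], of x] by (auto simp: enn2real_eq_0_iff)
  then show ?thesis using V_add_defect[OF f] by (metis add.right_neutral)
qed

end

text \<open>\<open>U\<close> is first bounded by some constant \<open>C\<close>. The upper growth bound applied to the contraction
  \<open>U / C\<close> then gives \<open>U f \<le> exp \<epsilon> * f\<close> for all \<open>\<epsilon> > 0\<close>, so \<open>U\<close> is itself a contraction and the
  lower growth bound applies.\<close>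

theorem slow_operator_is_identity:
  fixes H :: "('a \<Rightarrow> ennreal) set" and U :: "('a \<Rightarrow> ennreal) \<Rightarrow> 'a \<Rightarrow> ennreal"
  assumes finite_valued: "\<And>f x. f \<in> H \<Longrightarrow> f x < \<top>"
    and diff_mem: "\<And>f g. f \<in> H \<Longrightarrow> g \<in> H \<Longrightarrow> (\<And>x. g x \<le> f x) \<Longrightarrow> (\<lambda>x. f x - g x) \<in> H"
    and cmult_mem: "\<And>c f. c < \<top> \<Longrightarrow> f \<in> H \<Longrightarrow> (\<lambda>x. c * f x) \<in> H"
    and U_mem: "\<And>f. f \<in> H \<Longrightarrow> U f \<in> H"
    and U_add: "\<And>f g. f \<in> H \<Longrightarrow> g \<in> H \<Longrightarrow> U (\<lambda>x. f x + g x) = (\<lambda>x. U f x + U g x)"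
    and U_cmult: "\<And>c f. c < \<top> \<Longrightarrow> f \<in> H \<Longrightarrow> U (\<lambda>x. c * f x) = (\<lambda>x. c * U f x)"
    and growth: "\<And>\<epsilon>. \<epsilon> > 0 \<Longrightarrow> \<exists>N. \<forall>n\<ge>N. \<forall>f\<in>H. \<forall>x.
        (U ^^ n) f x \<le> ennreal (exp (\<epsilon> * real n)) * f x \<and>
        f x \<le> ennreal (exp (\<epsilon> * real n)) * (U ^^ n) f x"
    and f: "f \<in> H"
  shows "U f = f"
proof -
  have U_power_mem: "(U ^^ n) f \<in> H" if "f \<in> H" for f n
    using that by (induction n) (auto intro: U_mem)
  obtain C :: real where C: "C > 0" and U_bound: "\<And>f x. f \<in> H \<Longrightarrow> U f x \<le> ennreal C * f x"
  proof -
    obtain N where N: "\<And>n f x. n \<ge> N \<Longrightarrow> f \<in> H \<Longrightarrow> (U ^^ n) f x \<le> ennreal (exp (real n)) * f x"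
        "\<And>n f x. n \<ge> N \<Longrightarrow> f \<in> H \<Longrightarrow> f x \<le> ennreal (exp (real n)) * (U ^^ n) f x"
      using growth[of 1] by auto
    \<comment> \<open>The lower bound for \<open>U f\<close> raises the power to
      \<open>Suc N\<close>; the upper bound returns to \<open>f\<close>.\<close>
    have "U f x \<le> ennreal (exp (real N) * exp (real (Suc N))) * f x" if "f \<in> H" for f x
    proof -
      have "U f x \<le> ennreal (exp (real N)) * (U ^^ Suc N) f x"
        using N(2)[of N "U f" x] that U_mem by (simp add: funpow_swap1)
      also have "\<dots> \<le> ennreal (exp (real N)) * (ennreal (exp (real (Suc N))) * f x)"
        using N(1)[of "Suc N" f x] that by (intro mult_left_mono) auto
      finally show ?thesis by (simp add: ennreal_mult mult.assoc)
    qed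
    then show ?thesis by (intro that[of "exp (real N) * exp (real (Suc N))"]) auto
  qed
  define V where "V = (\<lambda>f x. ennreal (1 / C) * U f x)"
  have inv: "ennreal (1 / C) * (ennreal C * r) = r" for r
    using C by (simp add: ennreal_mult[symmetric] flip: mult.assoc)
  have V_power: "(V ^^ n) f = (\<lambda>x. ennreal ((1 / C) ^ n) * (U ^^ n) f x)" if "f \<in> H" for f n
  proof (induction n)
    case (Suc n)
    then have "(V ^^ Suc n) f = (\<lambda>x. ennreal (1 / C) * (ennreal ((1 / C) ^ n) * (U ^^ Suc n) f x))"
      using U_cmult[of "ennreal ((1 / C) ^ n)", OF _ U_power_mem[OF that, of n]] by (simp add: V_def)
    then show ?case
      using C by (simp add: ennreal_mult[symmetric] mult.assoc[symmetric])
  qed simp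
  interpret V: positive_contraction H V
  proof
    fix f x assume "f \<in> H"
    have "ennreal (1 / C) * U f x \<le> ennreal (1 / C) * (ennreal C * f x)"
      by (intro mult_left_mono U_bound \<open>f \<in> H\<close>) auto
    then show "V f x \<le> f x" by (simp only: inv V_def)
  qed (auto simp: V_def U_add distrib_left finite_valued cmult_mem U_mem diff_mem)
  have U_le_exp: "U f x \<le> ennreal (exp \<epsilon>) * f x" if f: "f \<in> H" and \<epsilon>: "\<epsilon> > 0" for f x \<epsilon>
  proof -
    obtain N where N: "\<And>n x. n \<ge> N \<Longrightarrow> (U ^^ n) f x \<le> ennreal (exp (\<epsilon> * real n)) * f x"
      using growth[OF \<epsilon>] f by blast
    \<comment> \<open>Scaling by \<open>1 / C\<close> changes the growth base to
      \<open>exp \<epsilon> / C\<close>, so the uncontrolled constant \<open>C\<close> cancels on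
      returning to \<open>U\<close>.\<close>
    have "V f x \<le> ennreal (1 / C * exp \<epsilon>) * f x"
    proof (rule V.V_le_of_growth[OF f])
      fix n assume n: "n \<ge> N"
      have "(V ^^ n) f x \<le> ennreal ((1 / C) ^ n) * (ennreal (exp (\<epsilon> * real n)) * f x)"
        unfolding V_power[OF f] by (intro mult_left_mono N n) auto
      also have "\<dots> = ennreal ((1 / C * exp \<epsilon>) ^ n) * f x"
        using C by (simp only: power_mult_distrib exp_of_nat2_mult flip: mult.assoc)
          (simp add: ennreal_mult)
      finally show "(V ^^ n) f x \<le> ennreal ((1 / C * exp \<epsilon>) ^ n) * f x" .
    qed (use C in simp)
    then have "ennreal C * (ennreal (1 / C) * U f x) \<le> ennreal C * (ennreal (1 / C * exp \<epsilon>) * f x)"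
      unfolding V_def by (intro mult_left_mono) auto
    then show ?thesis using C by (simp flip: mult.assoc ennreal_mult)
  qed
  have U_le: "U f x \<le> f x" if f: "f \<in> H" for f x
  proof (rule LIMSEQ_le_const)
    have "(\<lambda>k. ennreal (exp (inverse (real (Suc k))))) \<longlonglongrightarrow> ennreal (exp 0)"
      by (intro tendsto_ennrealI tendsto_exp LIMSEQ_inverse_real_of_nat)
    then show "(\<lambda>k. ennreal (exp (inverse (real (Suc k)))) * f x) \<longlonglongrightarrow> f x"
      using ennreal_tendsto_cmult[OF finite_valued[OF f, of x]] by (force simp: mult.commute)
  qed (use U_le_exp[OF f] in auto)
  interpret U: positive_contraction H U
    by standard (auto simp: U_add finite_valued U_mem diff_mem U_le)
  show ?thesis
    using U.V_eq_of_slow_decay[OF f] growth by (metis (no_types, lifting) ext)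
qed

subsection \<open>The harmonic part of a shifted harmonic function\<close>

text \<open>\<open>P\<close> abstracts the transition operator and \<open>\<tau>\<close> the
  translation. \<open>P_INF\<close> is monotone convergence for decreasing sequences, and
  \<open>P_shift_le\<close> is \<open>P T \<le> T P\<close>.\<close>

locale shifted_kernel =
  fixes P :: "('a \<Rightarrow> ennreal) \<Rightarrow> 'a \<Rightarrow> ennreal" and E :: "'a set" and \<tau> :: "'a \<Rightarrow> 'a"
  assumes P_add: "P (\<lambda>x. f x + g x) = (\<lambda>x. P f x + P g x)"
    and P_cmult: "P (\<lambda>x. c * f x) = (\<lambda>x. c * P f x)"
    and P_mono: "(\<And>x. f x \<le> g x) \<Longrightarrow> P f x \<le> P g x"
    and P_INF: "decseq F \<Longrightarrow> (\<And>x. P (F 0) x < \<top>) \<Longrightarrow> P (\<lambda>x. INF i. F i x) = (\<lambda>x. INF i. P (F i) x)"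
    and P_shift_le: "P (\<lambda>x. if x \<in> E then f (\<tau> x) else 0) x \<le> (if x \<in> E then P f (\<tau> x) else 0)"
begin

definition T :: "('a \<Rightarrow> ennreal) \<Rightarrow> 'a \<Rightarrow> ennreal" where
  "T f = (\<lambda>x. if x \<in> E then f (\<tau> x) else 0)"

definition H :: "('a \<Rightarrow> ennreal) set" where
  "H = {f. P f = f \<and> (\<forall>x. f x < \<top>)}"

text \<open>For \<open>f\<close> in \<open>H\<close> the iterates decrease, so the infimum is their
  limit: the greatest harmonic minorant of \<open>T f\<close>.\<close>

definition U :: "('a \<Rightarrow> ennreal) \<Rightarrow> 'a \<Rightarrow> ennreal" where
  "U f = (\<lambda>x. INF k. (P ^^ k) (T f) x)"

text \<open>Stands in for potentials: vanishing iterates are required rather than a representation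
  by the Green function.\<close>

definition null :: "('a \<Rightarrow> ennreal) \<Rightarrow> bool" where
  "null v \<longleftrightarrow> (\<forall>x. (\<lambda>k. (P ^^ k) v x) \<longlonglongrightarrow> 0)"

lemma P_power_add: "(P ^^ k) (\<lambda>x. f x + g x) = (\<lambda>x. (P ^^ k) f x + (P ^^ k) g x)"
  by (induction k) (simp_all add: P_add)

lemma P_power_cmult: "(P ^^ k) (\<lambda>x. c * f x) = (\<lambda>x. c * (P ^^ k) f x)"
  by (induction k) (simp_all add: P_cmult)

lemma P_power_mono: "(\<And>x. f x \<le> g x) \<Longrightarrow> (P ^^ k) f x \<le> (P ^^ k) g x"
  by (induction k arbitrary: x) (auto intro: P_mono)

lemma P_power_harmonic: "f \<in> H \<Longrightarrow> (P ^^ k) f = f"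
  by (induction k) (auto simp: H_def)

lemma P_T_le: "P (T f) x \<le> T (P f) x"
  using P_shift_le[of f x] by (simp add: T_def)

lemma P_power_T_le: "(P ^^ k) (T f) x \<le> T ((P ^^ k) f) x"
proof (induction k arbitrary: x)
  case (Suc k)
  have "P ((P ^^ k) (T f)) x \<le> P (T ((P ^^ k) f)) x" by (intro P_mono Suc)
  also have "\<dots> \<le> T (P ((P ^^ k) f)) x" by (rule P_T_le)
  finally show ?case by simp
qed simp

lemma T_finite: "f \<in> H \<Longrightarrow> T f x < \<top>"
  by (simp add: T_def H_def)

text \<open>\<open>T f\<close> is superharmonic, since
  \<open>P (T f) \<le> T (P f) = T f\<close>.\<close>

lemma decseq_P_power_T:
  assumes "f \<in> H"
  shows "decseq (\<lambda>k. (P ^^ k) (T f) x)"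
proof (rule decseq_SucI)
  fix k
  have "P (T f) y \<le> T f y" for y
    using P_T_le[of f y] assms by (simp add: H_def)
  then have "(P ^^ k) (P (T f)) x \<le> (P ^^ k) (T f) x" by (rule P_power_mono)
  then show "(P ^^ Suc k) (T f) x \<le> (P ^^ k) (T f) x" by (simp add: funpow_swap1)
qed

lemma tendsto_U:
  assumes "f \<in> H"
  shows "(\<lambda>k. (P ^^ k) (T f) x) \<longlonglongrightarrow> U f x"
  unfolding U_def by (rule LIMSEQ_INF[OF decseq_P_power_T[OF assms]])

lemma U_le_T: "U f x \<le> T f x"
  unfolding U_def by (rule INF_lower2[of 0]) auto

text \<open>\<open>P\<close> passes through the decreasing limit and merely shifts the sequence of
  iterates by one; finiteness comes from \<open>U f \<le> T f\<close>.\<close>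

lemma U_mem:
  assumes f: "f \<in> H"
  shows "U f \<in> H"
proof -
  have dec: "decseq (\<lambda>k. (P ^^ k) (T f))"
    using decseqD[OF decseq_P_power_T[OF f]] by (intro decseq_SucI le_funI) (simp del: funpow.simps)
  have "P (T f) x < \<top>" for x
    using decseqD[OF dec, of 0 1] T_finite[OF f, of x] by (auto simp: le_fun_def intro: le_less_trans)
  then have "P (U f) = (\<lambda>x. INF k. (P ^^ Suc k) (T f) x)"
    unfolding U_def using P_INF[OF dec] by simp
  also have "\<dots> = U f"
  proof
    fix x
    have "(\<lambda>k. (P ^^ Suc k) (T f) x) \<longlonglongrightarrow> U f x" by (rule LIMSEQ_Suc[OF tendsto_U[OF f]])
    moreover have "(\<lambda>k. (P ^^ Suc k) (T f) x) \<longlonglongrightarrow> (INF k. (P ^^ Suc k) (T f) x)"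
      using decseq_P_power_T[OF f, of x] by (intro LIMSEQ_INF) (simp add: decseq_Suc_iff del: funpow.simps)
    ultimately show "(INF k. (P ^^ Suc k) (T f) x) = U f x" by (rule LIMSEQ_unique[rotated])
  qed
  finally show ?thesis
    using le_less_trans[OF U_le_T T_finite[OF f]] by (simp add: H_def)
qed

lemma add_mem: "f \<in> H \<Longrightarrow> g \<in> H \<Longrightarrow> (\<lambda>x. f x + g x) \<in> H"
  by (simp add: H_def P_add)

lemma cmult_mem: "c < \<top> \<Longrightarrow> f \<in> H \<Longrightarrow> (\<lambda>x. c * f x) \<in> H"
  by (simp add: H_def P_cmult ennreal_mult_less_top)

text \<open>Additivity of \<open>P\<close> on \<open>(f - g) + g = f\<close>, followed by
  cancellation of the finite value \<open>g x\<close>.\<close>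

lemma diff_mem:
  assumes "f \<in> H" "g \<in> H" "\<And>x. g x \<le> f x"
  shows "(\<lambda>x. f x - g x) \<in> H"
proof -
  have "P (\<lambda>x. f x - g x) x = f x - g x" for x
  proof -
    have "(\<lambda>x. (f x - g x) + g x) = f"
      using assms(3) by (simp add: diff_add_cancel_ennreal)
    then have "P (\<lambda>x. f x - g x) x + g x = f x"
      using P_add[of "\<lambda>x. f x - g x" g] assms(1,2) by (simp add: H_def fun_eq_iff)
    moreover have "g x \<noteq> \<top>" using assms(2) by (simp add: H_def less_top)
    ultimately show ?thesis by (metis ennreal_add_diff_cancel_right)
  qed
  moreover have "f x - g x < \<top>" for x
    using assms(1) le_less_trans[OF diff_le_self_ennreal[of "f x" "g x"]] by (simp add: H_def)
  ultimately show ?thesis by (auto simp: H_def)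
qed

lemma U_add:
  assumes "f \<in> H" "g \<in> H"
  shows "U (\<lambda>x. f x + g x) = (\<lambda>x. U f x + U g x)"
proof
  fix x
  have "T (\<lambda>x. f x + g x) = (\<lambda>x. T f x + T g x)" by (auto simp: T_def)
  then have "(\<lambda>k. (P ^^ k) (T f) x + (P ^^ k) (T g) x) \<longlonglongrightarrow> U (\<lambda>x. f x + g x) x"
    using tendsto_U[OF add_mem[OF assms], of x] by (simp add: P_power_add)
  moreover have "(\<lambda>k. (P ^^ k) (T f) x + (P ^^ k) (T g) x) \<longlonglongrightarrow> U f x + U g x"
    by (intro tendsto_add tendsto_U assms)
  ultimately show "U (\<lambda>x. f x + g x) x = U f x + U g x" by (rule LIMSEQ_unique)
qed

lemma U_cmult:
  assumes "c < \<top>" "f \<in> H"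
  shows "U (\<lambda>x. c * f x) = (\<lambda>x. c * U f x)"
proof
  fix x
  have "T (\<lambda>x. c * f x) = (\<lambda>x. c * T f x)" by (auto simp: T_def)
  then have "(\<lambda>k. c * (P ^^ k) (T f) x) \<longlonglongrightarrow> U (\<lambda>x. c * f x) x"
    using tendsto_U[OF cmult_mem[OF assms], of x] by (simp add: P_power_cmult)
  moreover have "(\<lambda>k. c * (P ^^ k) (T f) x) \<longlonglongrightarrow> c * U f x"
    by (intro ennreal_tendsto_cmult tendsto_U assms)
  ultimately show "U (\<lambda>x. c * f x) x = c * U f x" by (rule LIMSEQ_unique)
qed

section \<open>Splitting shifted functions into a harmonic and a null part\<close>

lemma null_add: "null v \<Longrightarrow> null w \<Longrightarrow> null (\<lambda>x. v x + w x)"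
  unfolding null_def P_power_add using tendsto_add[where a = "0::ennreal" and b = 0] by fastforce

text \<open>The iterates of \<open>T v\<close> are squeezed between 0 and
  \<open>T ((P ^^ k) v)\<close>.\<close>

lemma null_T:
  assumes "null v"
  shows "null (T v)"
  unfolding null_def
proof
  fix x
  have lim: "(\<lambda>k. T ((P ^^ k) v) x) \<longlonglongrightarrow> 0"
    using assms by (cases "x \<in> E") (simp_all add: null_def T_def)
  show "(\<lambda>k. (P ^^ k) (T v) x) \<longlonglongrightarrow> 0"
    by (rule tendsto_sandwich[OF _ _ tendsto_const lim]) (auto simp: P_power_T_le)
qed

text \<open>The Riesz decomposition of the superharmonic function \<open>T f\<close>: as
  \<open>P\<close> fixes \<open>U f\<close>, the iterates of the remainder are
  \<open>(P ^^ k) (T f) - U f\<close> and tend to 0.\<close>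

lemma T_eq_U_add_null:
  assumes f: "f \<in> H"
  obtains v where "null v" "T f = (\<lambda>x. U f x + v x)"
proof
  define v where "v x = T f x - U f x" for x
  show Tf: "T f = (\<lambda>x. U f x + v x)"
    unfolding v_def by (metis (no_types) U_le_T add.commute diff_add_cancel_ennreal)
  show "null v"
    unfolding null_def
  proof
    fix x
    have fin: "U f x \<noteq> \<top>" using U_mem[OF f] by (simp add: H_def less_top)
    have "(P ^^ k) (T f) x = U f x + (P ^^ k) v x" for k
      unfolding Tf P_power_add P_power_harmonic[OF U_mem[OF f]] ..
    then have "(P ^^ k) v x = (P ^^ k) (T f) x - U f x" for k
      using fin by simp
    moreover have "(\<lambda>k. (P ^^ k) (T f) x - U f x) \<longlonglongrightarrow> U f x - U f x"
      using fin by (intro tendsto_diff_ennreal tendsto_U f) auto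
    ultimately show "(\<lambda>k. (P ^^ k) v x) \<longlonglongrightarrow> 0" using fin by (simp add: less_top)
  qed
qed

lemma U_power_mem: "f \<in> H \<Longrightarrow> (U ^^ n) f \<in> H"
  by (induction n) (auto intro: U_mem)

text \<open>One more \<open>T\<close> splits the harmonic part afresh, while the null part stays
  null under \<open>T\<close>.\<close>

lemma T_power_eq_U_power_add_null:
  assumes f: "f \<in> H"
  shows "\<exists>v. null v \<and> (T ^^ n) f = (\<lambda>x. (U ^^ n) f x + v x)"
proof (induction n)
  case 0
  have "(P ^^ k) (\<lambda>x. 0) = (\<lambda>x. 0)" for k
    using P_power_cmult[of k 0] by simp
  then show ?case by (intro exI[of _ "\<lambda>x. 0"]) (simp add: null_def)
next
  case (Suc n)
  then obtain v where v: "null v" "(T ^^ n) f = (\<lambda>x. (U ^^ n) f x + v x)" by blast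
  obtain w where w: "null w" "T ((U ^^ n) f) = (\<lambda>x. U ((U ^^ n) f) x + w x)"
    using T_eq_U_add_null[OF U_power_mem[OF f]] by blast
  have "(T ^^ Suc n) f = (\<lambda>x. T ((U ^^ n) f) x + T v x)"
    by (auto simp: v(2) T_def)
  also have "\<dots> = (\<lambda>x. (U ^^ Suc n) f x + (w x + T v x))"
    by (simp add: w(2) add.assoc)
  finally show ?case using null_add[OF w(1) null_T[OF v(1)]] by blast
qed

text \<open>Only the part of \<open>T ^^ n\<close> that survives iteration of \<open>P\<close> can dominate a harmonic function.\<close>

lemma harmonic_le_U_power:
  assumes f: "f \<in> H" and g: "g \<in> H" and c: "c < \<top>" and le: "\<And>x. g x \<le> c * (T ^^ n) f x"
  shows "g x \<le> c * (U ^^ n) f x"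
proof -
  obtain v where v: "null v" "(T ^^ n) f = (\<lambda>x. (U ^^ n) f x + v x)"
    using T_power_eq_U_power_add_null[OF f] by blast
  show ?thesis
  proof (rule LIMSEQ_le_const)
    have "(\<lambda>k. c * (U ^^ n) f x + c * (P ^^ k) v x) \<longlonglongrightarrow> c * (U ^^ n) f x + c * 0"
      using v(1) c by (intro tendsto_add tendsto_const ennreal_tendsto_cmult) (auto simp: null_def)
    then show "(\<lambda>k. c * (U ^^ n) f x + c * (P ^^ k) v x) \<longlonglongrightarrow> c * (U ^^ n) f x" by simp
    have "g x \<le> c * (U ^^ n) f x + c * (P ^^ k) v x" for k
    proof -
      have "g x = (P ^^ k) g x" using P_power_harmonic[OF g] by simp
      also have "\<dots> \<le> (P ^^ k) (\<lambda>x. c * ((U ^^ n) f x + v x)) x"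
        using le by (intro P_power_mono) (simp add: v(2))
      also have "\<dots> = c * (U ^^ n) f x + c * (P ^^ k) v x"
        by (simp add: P_power_cmult P_power_add P_power_harmonic[OF U_power_mem[OF f]] distrib_left)
      finally show ?thesis .
    qed
    then show "\<exists>N. \<forall>k\<ge>N. g x \<le> c * (U ^^ n) f x + c * (P ^^ k) v x" by blast
  qed
qed

lemma U_power_le_T_power:
  assumes "f \<in> H"
  shows "(U ^^ n) f x \<le> (T ^^ n) f x"
  using T_power_eq_U_power_add_null[OF assms, of n] by auto

text \<open>The growth bounds pass from \<open>T\<close> to \<open>U\<close>: the upper one by
  \<open>(U ^^ n) f \<le> (T ^^ n) f\<close>, the lower one by \<open>harmonic_le_U_power\<close>.
  Hence \<open>U\<close> is the identity on \<open>H\<close>.\<close>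

theorem P_power_T_tendsto:
  assumes growth: "\<And>\<epsilon>. \<epsilon> > 0 \<Longrightarrow> \<exists>N. \<forall>n\<ge>N. \<forall>f\<in>H. \<forall>x.
        (T ^^ n) f x \<le> ennreal (exp (\<epsilon> * real n)) * f x \<and>
        f x \<le> ennreal (exp (\<epsilon> * real n)) * (T ^^ n) f x"
    and f: "f \<in> H"
  shows "(\<lambda>k. (P ^^ k) (T f) x) \<longlonglongrightarrow> f x"
proof -
  have "U f = f"
  proof (rule slow_operator_is_identity[OF _ diff_mem cmult_mem U_mem U_add U_cmult _ f])
    fix \<epsilon> :: real
    assume "\<epsilon> > 0"
    then obtain N where N: "\<And>n f x. n \<ge> N \<Longrightarrow> f \<in> H \<Longrightarrow> (T ^^ n) f x \<le> ennreal (exp (\<epsilon> * real n)) * f x"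
        "\<And>n f x. n \<ge> N \<Longrightarrow> f \<in> H \<Longrightarrow> f x \<le> ennreal (exp (\<epsilon> * real n)) * (T ^^ n) f x"
      using growth[of \<epsilon>] by blast
    have "(U ^^ n) f x \<le> ennreal (exp (\<epsilon> * real n)) * f x \<and>
        f x \<le> ennreal (exp (\<epsilon> * real n)) * (U ^^ n) f x" if "n \<ge> N" "f \<in> H" for n f x
      using order_trans[OF U_power_le_T_power[OF that(2)] N(1)[OF that]]
        harmonic_le_U_power[OF that(2,2) _ N(2)[OF that]] by simp
    then show "\<exists>N. \<forall>n\<ge>N. \<forall>f\<in>H. \<forall>x.
        (U ^^ n) f x \<le> ennreal (exp (\<epsilon> * real n)) * f x \<and>
        f x \<le> ennreal (exp (\<epsilon> * real n)) * (U ^^ n) f x" by blast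
  qed (simp add: H_def)
  then show ?thesis using tendsto_U[OF f, of x] by simp
qed

end

subsection \<open>Markov property and stopped martingales\<close>

text \<open>Extension by 0 off \<open>E\<close> gives an operator on total functions that can be
  iterated with \<open>^^\<close>.\<close>

definition step :: "'a set \<Rightarrow> ('a \<Rightarrow> 'a \<Rightarrow> real) \<Rightarrow> ('a \<Rightarrow> ennreal) \<Rightarrow> 'a \<Rightarrow> ennreal" where
  "step E p f = (\<lambda>x. if x \<in> E then trans_op E p f x else 0)"

text \<open>The value 0 at the absorbing state makes the missing mass contribute nothing to
  expectations.\<close>

definition lift :: "('a \<Rightarrow> ennreal) \<Rightarrow> 'a option \<Rightarrow> ennreal" where
  "lift f s = (case s of None \<Rightarrow> 0 | Some y \<Rightarrow> f y)"

lemma lift_simps [simp]: "lift f None = 0" "lift f (Some y) = f y"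
  by (simp_all add: lift_def)

lemma nn_integral_ext_trans:
  assumes "s \<in> states E"
  shows "(\<integral>\<^sup>+ s'. ennreal (ext_trans E p s s') * lift f s' \<partial>count_space (states E)) = lift (step E p f) s"
proof -
  have "(\<integral>\<^sup>+ s'. ennreal (ext_trans E p s s') * lift f s' \<partial>count_space (states E))
      = (\<integral>\<^sup>+ s'. ennreal (ext_trans E p s s') * lift f s' \<partial>count_space (Some ` E))"
    by (rule nn_integral_count_space_eq) (auto simp: states_def)
  also have "\<dots> = (\<integral>\<^sup>+ y. ennreal (ext_trans E p s (Some y)) * f y \<partial>count_space E)"
    by (subst nn_integral_bij_count_space[symmetric, of Some E]) (simp_all add: bij_betw_def)
  also have "\<dots> = lift (step E p f) s"
    using assms by (cases s) (auto simp: states_def ext_trans_def step_def trans_op_def)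
  finally show ?thesis .
qed

text \<open>The law of total expectation for a countably valued map, obtained by interchanging sum
  and integral.\<close>

lemma nn_integral_countable_fibres:
  assumes "countable I" and Y: "Y \<in> measurable N (count_space I)" and f: "f \<in> borel_measurable N"
  shows "(\<integral>\<^sup>+ w. f w \<partial>N) = (\<integral>\<^sup>+ i. (\<integral>\<^sup>+ w. f w * indicator (Y -` {i} \<inter> space N) w \<partial>N) \<partial>count_space I)"
proof -
  have "(\<integral>\<^sup>+ i. f w * indicator (Y -` {i} \<inter> space N) w \<partial>count_space I) = f w" if w: "w \<in> space N" for w
    using measurable_space[OF Y w] w by (subst nn_integral_count_space'[of "{Y w}"]) auto
  then have "(\<integral>\<^sup>+ w. f w \<partial>N) = (\<integral>\<^sup>+ w. \<integral>\<^sup>+ i. f w * indicator (Y -` {i} \<inter> space N) w \<partial>count_space I \<partial>N)"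
    by (intro nn_integral_cong) simp
  also have "\<dots> = (\<integral>\<^sup>+ i. (\<integral>\<^sup>+ w. f w * indicator (Y -` {i} \<inter> space N) w \<partial>N) \<partial>count_space I)"
    using measurable_sets[OF Y] f
    by (intro nn_integral_count_space_nn_integral assms borel_measurable_times_ennreal borel_measurable_indicator) auto
  finally show ?thesis .
qed

locale markov_from = prob_space N for N :: "'w measure" +
  fixes E :: "'a set" and p :: "'a \<Rightarrow> 'a \<Rightarrow> real" and X :: "nat \<Rightarrow> 'w \<Rightarrow> 'a option" and x :: 'a
  assumes countable_E: "countable E"
    and start_mem: "x \<in> E"
    and X_measurable: "X t \<in> measurable N (count_space (states E))"
    and start: "\<P>(w in N. X 0 w = Some x) = 1"
    and markov: "(\<And>i. i \<le> Suc t \<Longrightarrow> s i \<in> states E) \<Longrightarrow>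
      \<P>(w in N. \<forall>i\<le>Suc t. X i w = s i) = \<P>(w in N. \<forall>i\<le>t. X i w = s i) * ext_trans E p (s t) (s (Suc t))"
begin

section \<open>Trajectories up to a fixed time and the Markov property\<close>

definition history :: "nat \<Rightarrow> 'w \<Rightarrow> 'a option list" where
  "history t w = map (\<lambda>i. X i w) [0..<Suc t]"

definition paths :: "nat \<Rightarrow> 'a option list set" where
  "paths t = {l \<in> lists (states E). length l = Suc t}"

lemma countable_states: "countable (states E)"
  using countable_E by (simp add: states_def)

lemma countable_paths: "countable (paths t)"
  unfolding paths_def using countable_states by (auto intro: countable_subset[OF _ countable_lists])

lemma X_in_states: "w \<in> space N \<Longrightarrow> X t w \<in> states E"
  using measurable_space[OF X_measurable] by simp

lemma length_history [simp]: "length (history t w) = Suc t"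
  by (simp add: history_def)

lemma history_nth: "i \<le> t \<Longrightarrow> history t w ! i = X i w"
  by (simp add: history_def del: upt_Suc)

lemma history_eq_iff:
  assumes "l \<in> paths t"
  shows "history t w = l \<longleftrightarrow> (\<forall>i\<le>t. X i w = l ! i)"
  using assms by (auto simp: list_eq_iff_nth_eq paths_def history_nth less_Suc_eq_le)

lemma X_eq_sets: "{w \<in> space N. X t w = s} \<in> sets N"
proof -
  have "X t -` ({s} \<inter> states E) \<inter> space N \<in> sets N"
    by (rule measurable_sets[OF X_measurable]) simp
  also have "X t -` ({s} \<inter> states E) \<inter> space N = {w \<in> space N. X t w = s}"
    using X_in_states by auto
  finally show ?thesis .
qed

lemma lift_X_measurable: "(\<lambda>w. lift f (X t w)) \<in> borel_measurable N"
  by (rule measurable_compose[OF X_measurable]) simp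

lemma history_measurable: "history t \<in> measurable N (count_space (paths t))"
  unfolding measurable_count_space_eq_countable[OF countable_paths]
proof (intro conjI ballI)
  show "history t \<in> space N \<rightarrow> paths t"
    using X_in_states by (auto simp: paths_def history_def)
  fix l assume "l \<in> paths t"
  then have "history t -` {l} \<inter> space N = {w \<in> space N. \<forall>i\<in>{..t}. X i w = l ! i}"
    by (auto simp: history_eq_iff history_nth)
  also have "\<dots> \<in> sets N"
    by (intro sets.sets_Collect_finite_All X_eq_sets) auto
  finally show "history t -` {l} \<inter> space N \<in> sets N" .
qed

text \<open>The Markov property for the trajectory that follows \<open>l\<close> and then moves to
  \<open>s\<close>.\<close>

lemma emeasure_history_step:
  assumes l: "l \<in> paths t" and s: "s \<in> states E"
  shows "emeasure N ((history t -` {l} \<inter> space N) \<inter> (X (Suc t) -` {s} \<inter> space N))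
    = emeasure N (history t -` {l} \<inter> space N) * ennreal (ext_trans E p (l ! t) s)"
proof -
  define r where "r i = (if i \<le> t then l ! i else s)" for i
  have "r i \<in> states E" for i
    using l s by (auto simp: r_def paths_def in_lists_conv_set less_Suc_eq_le)
  then have "\<P>(w in N. \<forall>i\<le>Suc t. X i w = r i) = \<P>(w in N. \<forall>i\<le>t. X i w = r i) * ext_trans E p (r t) (r (Suc t))"
    by (intro markov)
  moreover have "{w \<in> space N. \<forall>i\<le>Suc t. X i w = r i} = (history t -` {l} \<inter> space N) \<inter> (X (Suc t) -` {s} \<inter> space N)"
    using history_eq_iff[OF l] by (auto simp: r_def le_Suc_eq)
  moreover have "{w \<in> space N. \<forall>i\<le>t. X i w = r i} = history t -` {l} \<inter> space N"
    using history_eq_iff[OF l] by (auto simp: r_def)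
  ultimately show ?thesis
    by (simp add: emeasure_eq_measure ennreal_mult' r_def)
qed

text \<open>The Markov property as a conditional expectation, with a weight depending on the past.
  Both sides are split over the countably many histories; on each, summing over the next state
  produces \<open>step\<close>.\<close>

lemma nn_integral_step:
  "(\<integral>\<^sup>+ w. g (history t w) * lift f (X (Suc t) w) \<partial>N)
    = (\<integral>\<^sup>+ w. g (history t w) * lift (step E p f) (X t w) \<partial>N)"
proof -
  let ?A = "\<lambda>l. history t -` {l} \<inter> space N"
  let ?B = "\<lambda>s. X (Suc t) -` {s} \<inter> space N"
  have A: "?A l \<in> sets N" if "l \<in> paths t" for l
    using that by (intro measurable_sets[OF history_measurable]) simp
  have B: "?B s \<in> sets N" for s
    using X_eq_sets[of "Suc t" s] by (simp add: vimage_def Int_def conj_commute)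
  have g: "(\<lambda>w. g (history t w)) \<in> borel_measurable N"
    by (rule measurable_compose[OF history_measurable]) simp
  have inner: "(\<integral>\<^sup>+ w. g (history t w) * lift f (X (Suc t) w) * indicator (?A l) w \<partial>N)
      = g l * emeasure N (?A l) * lift (step E p f) (l ! t)" if l: "l \<in> paths t" for l
  proof -
    have "(\<integral>\<^sup>+ w. g (history t w) * lift f (X (Suc t) w) * indicator (?A l) w \<partial>N)
        = (\<integral>\<^sup>+ s. (\<integral>\<^sup>+ w. g (history t w) * lift f (X (Suc t) w) * indicator (?A l) w * indicator (?B s) w \<partial>N)
            \<partial>count_space (states E))"
      using g A[OF l] by (intro nn_integral_countable_fibres countable_states X_measurable
          borel_measurable_times_ennreal lift_X_measurable borel_measurable_indicator)
    also have "\<dots> = (\<integral>\<^sup>+ s. g l * emeasure N (?A l) * (ennreal (ext_trans E p (l ! t) s) * lift f s)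
            \<partial>count_space (states E))"
    proof (rule nn_integral_cong)
      fix s assume "s \<in> space (count_space (states E))"
      then have s: "s \<in> states E" by simp
      have "(\<integral>\<^sup>+ w. g (history t w) * lift f (X (Suc t) w) * indicator (?A l) w * indicator (?B s) w \<partial>N)
        = (\<integral>\<^sup>+ w. g l * lift f s * indicator (?A l \<inter> ?B s) w \<partial>N)"
        by (intro nn_integral_cong) (auto split: split_indicator)
      also have "\<dots> = g l * lift f s * emeasure N (?A l \<inter> ?B s)"
        using A[OF l] B by (intro nn_integral_cmult_indicator) auto
      finally show "(\<integral>\<^sup>+ w. g (history t w) * lift f (X (Suc t) w) * indicator (?A l) w * indicator (?B s) w \<partial>N)
        = g l * emeasure N (?A l) * (ennreal (ext_trans E p (l ! t) s) * lift f s)"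
        unfolding emeasure_history_step[OF l s] by (simp add: mult_ac)
    qed
    also have "\<dots> = g l * emeasure N (?A l) * lift (step E p f) (l ! t)"
      using l by (subst nn_integral_cmult) (auto simp: nn_integral_ext_trans paths_def)
    finally show ?thesis .
  qed
  have inner': "(\<integral>\<^sup>+ w. g (history t w) * lift (step E p f) (X t w) * indicator (?A l) w \<partial>N)
      = g l * emeasure N (?A l) * lift (step E p f) (l ! t)" if l: "l \<in> paths t" for l
  proof -
    have "(\<integral>\<^sup>+ w. g (history t w) * lift (step E p f) (X t w) * indicator (?A l) w \<partial>N)
        = (\<integral>\<^sup>+ w. g l * lift (step E p f) (l ! t) * indicator (?A l) w \<partial>N)"
      using history_nth[of t t] by (intro nn_integral_cong) (auto split: split_indicator)
    also have "\<dots> = g l * lift (step E p f) (l ! t) * emeasure N (?A l)"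
      by (intro nn_integral_cmult_indicator A l)
    finally show ?thesis by (simp only: mult_ac)
  qed
  note fibres = nn_integral_countable_fibres[OF countable_paths history_measurable
      borel_measurable_times_ennreal[OF g lift_X_measurable]]
  have "(\<integral>\<^sup>+ w. g (history t w) * lift f (X (Suc t) w) \<partial>N)
      = (\<integral>\<^sup>+ l. g l * emeasure N (?A l) * lift (step E p f) (l ! t) \<partial>count_space (paths t))"
    by (subst fibres, rule nn_integral_cong) (simp add: inner)
  also have "\<dots> = (\<integral>\<^sup>+ w. g (history t w) * lift (step E p f) (X t w) \<partial>N)"
    by (subst fibres, rule nn_integral_cong) (simp add: inner')
  finally show ?thesis .
qed

lemma AE_start: "AE w in N. X 0 w = Some x"
  using start X_eq_sets[of 0 "Some x"] by (subst (asm) prob_Collect_eq_1) (auto simp: pred_def)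

lemma nn_integral_start: "(\<integral>\<^sup>+ w. lift f (X 0 w) \<partial>N) = f x"
proof -
  have "(\<integral>\<^sup>+ w. lift f (X 0 w) \<partial>N) = (\<integral>\<^sup>+ w. f x \<partial>N)"
    using AE_start by (intro nn_integral_cong_AE) auto
  then show ?thesis by (simp add: emeasure_space_1)
qed

lemma nn_integral_X: "(\<integral>\<^sup>+ w. lift f (X t w) \<partial>N) = (step E p ^^ t) f x"
proof (induction t arbitrary: f)
  case (Suc t)
  have "(\<integral>\<^sup>+ w. lift f (X (Suc t) w) \<partial>N) = (\<integral>\<^sup>+ w. lift (step E p f) (X t w) \<partial>N)"
    using nn_integral_step[of "\<lambda>_. 1" t f] by simp
  then show ?case by (simp add: Suc funpow_swap1)
qed (simp add: nn_integral_start)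

text \<open>Integration against the law of \<open>X t\<close> is the \<open>t\<close>-th power of
  the transition operator; this turns the Green operator into the sum of these powers.\<close>

lemma nn_integral_prob_X:
  "(\<integral>\<^sup>+ y. ennreal \<P>(w in N. X t w = Some y) * f y \<partial>count_space E) = (step E p ^^ t) f x"
proof -
  have B: "X t -` {s} \<inter> space N \<in> sets N" "X t -` {s} \<inter> space N = {w \<in> space N. X t w = s}" for s
    using X_eq_sets[of t s] by (auto simp: vimage_def Int_def conj_commute)
  have "(step E p ^^ t) f x = (\<integral>\<^sup>+ s. (\<integral>\<^sup>+ w. lift f (X t w) * indicator (X t -` {s} \<inter> space N) w \<partial>N) \<partial>count_space (states E))"
    unfolding nn_integral_X[symmetric]
    by (intro nn_integral_countable_fibres countable_states X_measurable lift_X_measurable)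
  also have "\<dots> = (\<integral>\<^sup>+ s. ennreal \<P>(w in N. X t w = s) * lift f s \<partial>count_space (states E))"
  proof (rule nn_integral_cong)
    fix s
    have "(\<integral>\<^sup>+ w. lift f (X t w) * indicator (X t -` {s} \<inter> space N) w \<partial>N)
      = (\<integral>\<^sup>+ w. lift f s * indicator (X t -` {s} \<inter> space N) w \<partial>N)"
      by (intro nn_integral_cong) (auto split: split_indicator)
    also have "\<dots> = lift f s * emeasure N (X t -` {s} \<inter> space N)"
      by (intro nn_integral_cmult_indicator B)
    finally show "(\<integral>\<^sup>+ w. lift f (X t w) * indicator (X t -` {s} \<inter> space N) w \<partial>N) = ennreal \<P>(w in N. X t w = s) * lift f s"
      by (simp add: B(2) emeasure_eq_measure mult.commute)
  qed
  also have "\<dots> = (\<integral>\<^sup>+ s. ennreal \<P>(w in N. X t w = s) * lift f s \<partial>count_space (Some ` E))"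
    by (rule nn_integral_count_space_eq) (auto simp: states_def)
  also have "\<dots> = (\<integral>\<^sup>+ y. ennreal \<P>(w in N. X t w = Some y) * f y \<partial>count_space E)"
    by (subst nn_integral_bij_count_space[symmetric, of Some E]) (simp_all add: bij_betw_def)
  finally show ?thesis ..
qed

text \<open>Time 0 is excluded, in agreement with \<open>hitting\<close>.\<close>

definition hit :: "'a \<Rightarrow> nat \<Rightarrow> 'w set" where
  "hit y n = {w \<in> space N. \<exists>t\<in>{0<..n}. X t w = Some y}"

lemma hit_sets: "hit y n \<in> sets N"
  unfolding hit_def by (intro sets.sets_Collect_finite_Ex X_eq_sets) auto

text \<open>The harmonic function evaluated along the chain stopped at the first visit to \<open>y\<close> is a martingale.\<close>

lemma nn_integral_stopped:
  assumes h: "step E p h = h"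
  shows "(\<integral>\<^sup>+ w. (if w \<in> hit y n then h y else lift h (X n w)) \<partial>N) = h x"
proof (induction n)
  case 0
  then show ?case by (simp add: hit_def nn_integral_start)
next
  case (Suc n)
  \<comment> \<open>The indicator of no visit up to time \<open>n\<close>, written as a function of
    the history so that the one-step identity applies.\<close>
  define g where "g l = (if \<exists>t\<in>{0<..n}. l ! t = Some y then 0 else 1 :: ennreal)" for l
  have g: "g (history n w) = (if w \<in> hit y n then 0 else 1)" if "w \<in> space N" for w
    using that by (auto simp: g_def hit_def history_nth)
  have g_meas: "(\<lambda>w. g (history n w)) \<in> borel_measurable N"
    by (rule measurable_compose[OF history_measurable]) simp
  have "(\<integral>\<^sup>+ w. (if w \<in> hit y (Suc n) then h y else lift h (X (Suc n) w)) \<partial>N)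
      = (\<integral>\<^sup>+ w. h y * indicator (hit y n) w + g (history n w) * lift h (X (Suc n) w) \<partial>N)"
  proof (rule nn_integral_cong)
    fix w assume w: "w \<in> space N"
    have "w \<in> hit y (Suc n) \<longleftrightarrow> w \<in> hit y n \<or> X (Suc n) w = Some y"
      using w by (auto simp: hit_def le_Suc_eq)
    \<comment> \<open>A first visit at time \<open>Suc n\<close> belongs to the second summand,
      where \<open>lift h\<close> also takes the value \<open>h y\<close>.\<close>
    then show "(if w \<in> hit y (Suc n) then h y else lift h (X (Suc n) w))
        = h y * indicator (hit y n) w + g (history n w) * lift h (X (Suc n) w)"
      using g[OF w] by (auto simp: indicator_def)
  qed
  also have "\<dots> = (\<integral>\<^sup>+ w. h y * indicator (hit y n) w \<partial>N) + (\<integral>\<^sup>+ w. g (history n w) * lift h (X (Suc n) w) \<partial>N)"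
    using g_meas hit_sets by (intro nn_integral_add borel_measurable_times_ennreal lift_X_measurable) auto
  also have "\<dots> = (\<integral>\<^sup>+ w. h y * indicator (hit y n) w \<partial>N) + (\<integral>\<^sup>+ w. g (history n w) * lift h (X n w) \<partial>N)"
    by (simp only: nn_integral_step h)
  also have "\<dots> = (\<integral>\<^sup>+ w. h y * indicator (hit y n) w + g (history n w) * lift h (X n w) \<partial>N)"
    using g_meas hit_sets by (intro nn_integral_add[symmetric] borel_measurable_times_ennreal lift_X_measurable) auto
  also have "\<dots> = (\<integral>\<^sup>+ w. (if w \<in> hit y n then h y else lift h (X n w)) \<partial>N)"
    using g by (intro nn_integral_cong) (auto simp: indicator_def)
  finally show ?case using Suc.IH by simp
qed

text \<open>Dropping the paths that have not yet visited \<open>y\<close> from the stopped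
  martingale leaves \<open>h y\<close> times the probability of a visit by time \<open>n\<close>;
  then \<open>n\<close> tends to infinity.\<close>

lemma harmonic_ge_hitting:
  assumes h: "step E p h = h" and fin: "h y < \<top>"
  shows "ennreal \<P>(w in N. \<exists>t>0. X t w = Some y) * h y \<le> h x"
proof (rule LIMSEQ_le_const2)
  have "(\<lambda>n. emeasure N (hit y n)) \<longlonglongrightarrow> emeasure N (\<Union>n. hit y n)"
    using hit_sets by (intro Lim_emeasure_incseq) (auto simp: incseq_def hit_def)
  also have "(\<Union>n. hit y n) = {w \<in> space N. \<exists>t>0. X t w = Some y}"
    by (force simp: hit_def)
  finally have "(\<lambda>n. h y * emeasure N (hit y n)) \<longlonglongrightarrow> h y * ennreal \<P>(w in N. \<exists>t>0. X t w = Some y)"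
    using fin by (intro ennreal_tendsto_cmult) (simp_all add: emeasure_eq_measure)
  then show "(\<lambda>n. h y * emeasure N (hit y n)) \<longlonglongrightarrow> ennreal \<P>(w in N. \<exists>t>0. X t w = Some y) * h y"
    by (simp add: mult.commute)
  have "h y * emeasure N (hit y n) \<le> h x" for n
  proof -
    have "h y * emeasure N (hit y n) = (\<integral>\<^sup>+ w. h y * indicator (hit y n) w \<partial>N)"
      by (simp add: nn_integral_cmult_indicator hit_sets)
    also have "\<dots> \<le> (\<integral>\<^sup>+ w. (if w \<in> hit y n then h y else lift h (X n w)) \<partial>N)"
      by (intro nn_integral_mono) (auto simp: indicator_def)
    finally show ?thesis by (simp add: nn_integral_stopped[OF h])
  qed
  then show "\<exists>N'. \<forall>n\<ge>N'. h y * emeasure N (hit y n) \<le> h x" by blast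
qed

lemma prob_X_le_hitting:
  assumes "n \<ge> 1"
  shows "\<P>(w in N. X n w = Some y) \<le> \<P>(w in N. \<exists>t>0. X t w = Some y)"
proof (rule finite_measure_mono)
  show "{w \<in> space N. X n w = Some y} \<subseteq> {w \<in> space N. \<exists>t>0. X t w = Some y}"
    using assms by (auto intro!: exI[of _ n])
  have "{w \<in> space N. \<exists>t>0. X t w = Some y} = (\<Union>n. hit y n)"
    by (force simp: hit_def)
  then show "{w \<in> space N. \<exists>t>0. X t w = Some y} \<in> sets N"
    using hit_sets by auto
qed

end

lemma markov_chain_imp_markov_from:
  assumes "countable E" "markov_chain E p M X" "x \<in> E"
  shows "markov_from (M x) E p X x"
  using assms unfolding markov_chain_def markov_from_def markov_from_axioms_def by simp

subsection \<open>Translation by a group element\<close>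

lemma step_add: "step E p (\<lambda>x. f x + g x) = (\<lambda>x. step E p f x + step E p g x)"
  by (auto simp: step_def trans_op_def distrib_left nn_integral_add)

lemma step_cmult: "step E p (\<lambda>x. c * f x) = (\<lambda>x. c * step E p f x)"
  by (auto simp: step_def trans_op_def nn_integral_cmult mult.left_commute)

lemma step_mono: "(\<And>x. x \<in> E \<Longrightarrow> f x \<le> g x) \<Longrightarrow> step E p f x \<le> step E p g x"
  by (auto simp: step_def trans_op_def intro!: nn_integral_mono mult_left_mono)

text \<open>Decreasing monotone convergence, available because the first sum is finite; the finite
  factor \<open>p x y\<close> passes through the infimum.\<close>

lemma step_INF:
  assumes "decseq F" and "\<And>x. step E p (F 0) x < \<top>"
  shows "step E p (\<lambda>x. INF i. F i x) = (\<lambda>x. INF i. step E p (F i) x)"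
proof
  fix x
  show "step E p (\<lambda>x. INF i. F i x) x = (INF i. step E p (F i) x)"
  proof (cases "x \<in> E")
    case True
    have "ennreal (p x y) * (INF i. F i y) = (INF i. ennreal (p x y) * F i y)" for y
    proof -
      have "decseq (\<lambda>i. F i y)" by (intro decseq_SucI le_funD[OF decseqD[OF assms(1)]]) simp
      then have dec: "decseq (\<lambda>i. ennreal (p x y) * F i y)"
        by (auto simp: decseq_def intro: mult_left_mono)
      have "(\<lambda>i. ennreal (p x y) * F i y) \<longlonglongrightarrow> ennreal (p x y) * (INF i. F i y)"
        by (intro ennreal_tendsto_cmult LIMSEQ_INF \<open>decseq (\<lambda>i. F i y)\<close>) simp
      then show ?thesis by (rule LIMSEQ_unique[OF _ LIMSEQ_INF[OF dec]])
    qed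
    then have "step E p (\<lambda>x. INF i. F i x) x = (\<integral>\<^sup>+ y. (INF i. ennreal (p x y) * F i y) \<partial>count_space E)"
      using True by (simp add: step_def trans_op_def)
    also have "\<dots> = (INF i. \<integral>\<^sup>+ y. ennreal (p x y) * F i y \<partial>count_space E)"
    proof (rule nn_integral_monotone_convergence_INF_decseq)
      show "decseq (\<lambda>i y. ennreal (p x y) * F i y)"
        by (intro decseq_SucI le_funI mult_left_mono le_funD[OF decseqD[OF assms(1)]]) simp_all
      show "(\<integral>\<^sup>+ y. ennreal (p x y) * F 0 y \<partial>count_space E) < \<infinity>"
        using assms(2)[of x] True by (simp add: step_def trans_op_def)
    qed simp
    finally show ?thesis using True by (simp add: step_def trans_op_def)
  qed (simp add: step_def)
qed

section \<open>The kernel compared with its translate\<close>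

locale right_translation = group G for G :: "('a, 'b) monoid_scheme" (structure) +
  fixes E :: "'a set" and p :: "'a \<Rightarrow> 'a \<Rightarrow> real" and u :: 'a
  assumes E_carrier: "E \<subseteq> carrier G" and u_mem: "u \<in> E" and E_u: "E #> u \<subseteq> E"
    and substochastic: "substochastic E p"
    and p_shift: "x \<in> E \<Longrightarrow> y \<in> E \<Longrightarrow> p x y \<le> p (x \<otimes> u) (y \<otimes> u)"
begin

lemma u_carrier: "u \<in> carrier G"
  using E_carrier u_mem by blast

lemma shift_mem: "x \<in> E \<Longrightarrow> x \<otimes> u \<in> E"
  using E_u by (auto simp: r_coset_def)

lemma bij_betw_shift: "bij_betw (\<lambda>y. y \<otimes> u) E (E #> u)"
proof -
  have "inj_on (\<lambda>y. y \<otimes> u) E"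
    using E_carrier u_carrier by (auto intro!: inj_onI simp: subset_iff)
  then show ?thesis by (auto simp: bij_betw_def r_coset_def)
qed

lemma shift_inverse: "y \<in> E \<Longrightarrow> y \<otimes> u \<otimes> inv u = y"
  using E_carrier u_carrier by (simp add: m_assoc subset_iff)

text \<open>The row of \<open>p\<close> at \<open>x \<otimes> u\<close> splits into the row at
  \<open>x\<close> carried over to the coset \<open>E #> u\<close> and the nonnegative remainder
  \<open>shift_diff\<close>. In operator form, \<open>T P = P T + A_u\<close> on
  \<open>E\<close>.\<close>

lemma trans_op_shift:
  assumes x: "x \<in> E"
  shows "trans_op E p f (x \<otimes> u) = trans_op E p (\<lambda>y. f (y \<otimes> u)) x + shift_diff_op G E p u f x"
proof -
  let ?q = "\<lambda>z. if z \<in> E #> u then ennreal (p x (z \<otimes> inv u)) else 0"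
  have split: "ennreal (p (x \<otimes> u) z) = ?q z + ennreal (shift_diff G E p u x z)" if z: "z \<in> E" for z
  proof (cases "z \<in> E #> u")
    case True
    then obtain y where y: "y \<in> E" "z = y \<otimes> u" by (auto simp: r_coset_def)
    have "0 \<le> p x y" using substochastic x y(1) by (simp add: substochastic_def)
    moreover have "0 \<le> shift_diff G E p u x z"
      using shift_diff_nonneg[OF is_group E_carrier u_mem E_u substochastic p_shift x z] .
    moreover have "p (x \<otimes> u) z = p x y + shift_diff G E p u x z"
      using True y by (simp add: shift_diff_def shift_inverse)
    ultimately show ?thesis using True y by (simp add: shift_inverse)
  qed (simp add: shift_diff_def)
  have "trans_op E p f (x \<otimes> u) = (\<integral>\<^sup>+ z. ?q z * f z + ennreal (shift_diff G E p u x z) * f z \<partial>count_space E)"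
    unfolding trans_op_def by (intro nn_integral_cong) (simp only: split distrib_right space_count_space)
  also have "\<dots> = (\<integral>\<^sup>+ z. ?q z * f z \<partial>count_space E) + shift_diff_op G E p u f x"
    by (simp add: nn_integral_add shift_diff_op_def)
  \<comment> \<open>\<open>?q\<close> vanishes off the coset, on which the substitution
    \<open>z = y \<otimes> u\<close> is a bijection from \<open>E\<close>.\<close>
  also have "(\<integral>\<^sup>+ z. ?q z * f z \<partial>count_space E) = (\<integral>\<^sup>+ z. ?q z * f z \<partial>count_space (E #> u))"
    using E_u by (intro nn_integral_count_space_eq) auto
  also have "\<dots> = (\<integral>\<^sup>+ y. ?q (y \<otimes> u) * f (y \<otimes> u) \<partial>count_space E)"
    by (rule nn_integral_bij_count_space[OF bij_betw_shift, symmetric])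
  also have "\<dots> = trans_op E p (\<lambda>y. f (y \<otimes> u)) x"
    unfolding trans_op_def
    by (intro nn_integral_cong) (auto simp: shift_inverse r_coset_def)
  finally show ?thesis .
qed

text \<open>The inequality \<open>P T \<le> T P\<close> results from dropping the nonnegative term
  \<open>A_u f\<close> in \<open>trans_op_shift\<close>.\<close>

sublocale shifted_kernel "step E p" E "\<lambda>x. x \<otimes> u"
proof
  fix f :: "'a \<Rightarrow> ennreal" and x
  have "step E p (\<lambda>y. if y \<in> E then f (y \<otimes> u) else 0) x = step E p (\<lambda>y. f (y \<otimes> u)) x"
    by (intro antisym step_mono) auto
  then show "step E p (\<lambda>x. if x \<in> E then f (x \<otimes> u) else 0) x \<le> (if x \<in> E then step E p f (x \<otimes> u) else 0)"
    using trans_op_shift[of x f] by (auto simp: step_def shift_mem)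
qed (auto intro: step_add step_cmult step_mono step_INF)

lemma T_power: "x \<in> E \<Longrightarrow> (T ^^ n) f x = f (x \<otimes> u [^] n)"
proof (induction n arbitrary: x)
  case 0
  then show ?case using E_carrier by (auto simp: subset_iff)
next
  case (Suc n)
  have "x \<in> carrier G" using E_carrier Suc.prems by blast
  \<comment> \<open>The first factor \<open>u\<close> is split off, since the outermost
    \<open>T\<close> moves the base point to \<open>x \<otimes> u\<close>.\<close>
  then have "x \<otimes> u [^] Suc n = x \<otimes> u \<otimes> u [^] n"
    using u_carrier by (subst nat_pow_Suc2) (simp_all add: m_assoc)
  then show ?case
    using Suc.IH[OF shift_mem[OF Suc.prems]] Suc.prems by (simp only: funpow.simps o_apply T_def if_True)
qed

lemma shift_power_mem: "x \<in> E \<Longrightarrow> x \<otimes> u [^] (n::nat) \<in> E"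
proof (induction n)
  case 0
  then show ?case using E_carrier by (auto simp: subset_iff)
next
  case (Suc n)
  have "x \<otimes> u [^] Suc n = x \<otimes> u [^] n \<otimes> u"
    using E_carrier Suc.prems u_carrier by (auto simp: m_assoc subset_iff)
  then show ?case using Suc shift_mem by simp
qed

lemma harmonic_outside:
  assumes "f \<in> H" "y \<notin> E"
  shows "f y = 0"
proof -
  have "f y = step E p f y" using assms(1) by (simp add: H_def)
  also have "\<dots> = 0" using assms(2) by (simp add: step_def)
  finally show ?thesis .
qed

text \<open>The Poisson equation for \<open>T f\<close> with right-hand side \<open>A_u f\<close>,
  from \<open>trans_op_shift\<close> and \<open>P f = f\<close>.\<close>

lemma T_eq:
  assumes "f \<in> H"
  shows "T f = (\<lambda>x. step E p (T f) x + (if x \<in> E then shift_diff_op G E p u f x else 0))"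
proof
  fix x
  show "T f x = step E p (T f) x + (if x \<in> E then shift_diff_op G E p u f x else 0)"
  proof (cases "x \<in> E")
    case True
    have "T f x = step E p f (x \<otimes> u)" using assms True by (simp add: T_def H_def)
    also have "\<dots> = trans_op E p (\<lambda>y. f (y \<otimes> u)) x + shift_diff_op G E p u f x"
      using trans_op_shift[OF True] True by (simp add: step_def shift_mem)
    also have "trans_op E p (\<lambda>y. f (y \<otimes> u)) x = step E p (T f) x"
      using True unfolding step_def trans_op_def by (auto simp: T_def intro!: nn_integral_cong)
    finally show ?thesis using True by simp
  qed (simp add: T_def step_def)
qed

end

section \<open>Growth bounds from slow variation, and the Green expansion\<close>

theorem theorem1:
  fixes G :: "('a, 'b) monoid_scheme"
    and E :: "'a set"
    and p :: "'a \<Rightarrow> 'a \<Rightarrow> real"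
    and M :: "'a \<Rightarrow> 'w measure"
    and X :: "nat \<Rightarrow> 'w \<Rightarrow> 'a option"
    and u :: 'a
    and h :: "'a \<Rightarrow> real"
  assumes "countable E"
    and "substochastic E p"
    and "markov_chain E p M X"
    and "irreducible_chain E M X"
    and "transient_chain E M X"
    and "group G"
    and "E \<subseteq> carrier G"
    and "u \<in> E"
    and "E #>\<^bsub>G\<^esub> u \<subseteq> E"
    and "\<And>x y. x \<in> E \<Longrightarrow> y \<in> E \<Longrightarrow> p (x \<otimes>\<^bsub>G\<^esub> u) (y \<otimes>\<^bsub>G\<^esub> u) \<ge> p x y"
    and "slowly_varying_hitting G E M X u"
    and "harmonic E p h"
  shows "\<forall>y\<in>E. ennreal (h (y \<otimes>\<^bsub>G\<^esub> u)) =
           ennreal (h y) + green_op E M X (shift_diff_op G E p u (\<lambda>z. ennreal (h z))) y"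
proof
  fix x assume x: "x \<in> E"
  interpret right_translation G E p u
    by (intro right_translation.intro right_translation_axioms.intro) (fact assms)+
  have chain: "markov_from (M y) E p X y" if "y \<in> E" for y
    using markov_chain_imp_markov_from[OF assms(1,3) that] .
  let ?Q = "hitting M X"
  \<comment> \<open>Positivity, supplied by irreducibility, lets a bound on the logarithm become a
    lower bound on the hitting probability.\<close>
  have Q_pos: "0 < ?Q y z" if yz: "y \<in> E" "z \<in> E" for y z
  proof -
    interpret markov_from "M y" E p X y by (rule chain[OF yz(1)])
    obtain n where n: "n \<ge> 1" "0 < \<P>(w in M y. X n w = Some z)"
      using assms(4)[unfolded irreducible_chain_def, rule_format, OF yz] by blast
    from n(2) prob_X_le_hitting[OF n(1), of z] show ?thesis
      unfolding hitting_def by (rule less_le_trans)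
  qed
  have Q_le: "f z \<le> ennreal (exp r) * f y"
    if "f \<in> H" "y \<in> E" "z \<in> E" "exp (- r) \<le> ?Q y z" for f y z r
  proof -
    interpret markov_from "M y" E p X y by (rule chain[OF that(2)])
    have "ennreal (exp (- r)) * f z \<le> ennreal (?Q y z) * f z"
      using that(4) by (intro mult_right_mono ennreal_leI) auto
    also have "\<dots> \<le> f y"
      unfolding hitting_def using that(1) by (intro harmonic_ge_hitting) (auto simp: H_def)
    finally have "ennreal (exp r) * (ennreal (exp (- r)) * f z) \<le> ennreal (exp r) * f y"
      by (intro mult_left_mono) auto
    then show ?thesis by (simp add: exp_minus flip: mult.assoc ennreal_mult)
  qed
  have growth: "\<exists>N. \<forall>n\<ge>N. \<forall>f\<in>H. \<forall>y.
        (T ^^ n) f y \<le> ennreal (exp (\<epsilon> * real n)) * f y \<and>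
        f y \<le> ennreal (exp (\<epsilon> * real n)) * (T ^^ n) f y" if \<epsilon>: "\<epsilon> > 0" for \<epsilon> :: real
  proof -
    \<comment> \<open>The condition \<open>n > 0\<close> allows the factor \<open>1 / real n\<close>
      to be cleared; at \<open>n = 0\<close> it is 0 by convention.\<close>
    have "\<forall>\<^sub>F n in sequentially. n > 0 \<and>
        (\<forall>y\<in>E. dist (1 / real n * ln (?Q y (y \<otimes>\<^bsub>G\<^esub> u [^]\<^bsub>G\<^esub> n))) 0 < \<epsilon>) \<and>
        (\<forall>y\<in>E. dist (1 / real n * ln (?Q (y \<otimes>\<^bsub>G\<^esub> u [^]\<^bsub>G\<^esub> n) y)) 0 < \<epsilon>)"
      using assms(11) \<epsilon> unfolding slowly_varying_hitting_def
      by (intro eventually_conj eventually_gt_at_top) (auto dest!: uniform_limitD)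
    then obtain N where N: "\<And>n. n \<ge> N \<Longrightarrow> n > 0"
        "\<And>n y. n \<ge> N \<Longrightarrow> y \<in> E \<Longrightarrow> \<bar>1 / real n * ln (?Q y (y \<otimes>\<^bsub>G\<^esub> u [^]\<^bsub>G\<^esub> n))\<bar> < \<epsilon>"
        "\<And>n y. n \<ge> N \<Longrightarrow> y \<in> E \<Longrightarrow> \<bar>1 / real n * ln (?Q (y \<otimes>\<^bsub>G\<^esub> u [^]\<^bsub>G\<^esub> n) y)\<bar> < \<epsilon>"
      unfolding eventually_sequentially by (auto simp: dist_real_def)
    have exp_le: "exp (- (\<epsilon> * real n)) \<le> q" if "n > 0" "0 < q" "\<bar>1 / real n * ln q\<bar> < \<epsilon>" for n q
    proof -
      have "- \<epsilon> * real n \<le> ln q" using that by (simp add: abs_less_iff field_simps)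
      then show ?thesis using that(2) by (simp add: ln_ge_iff)
    qed
    have "(T ^^ n) f y \<le> ennreal (exp (\<epsilon> * real n)) * f y \<and>
        f y \<le> ennreal (exp (\<epsilon> * real n)) * (T ^^ n) f y" if n: "n \<ge> N" and f: "f \<in> H" for n f y
    proof (cases "y \<in> E")
      case True
      \<comment> \<open>Hitting the shifted point from \<open>y\<close> bounds
        \<open>(T ^^ n) f y\<close> above; hitting \<open>y\<close> from the shifted point bounds it
        below.\<close>
      note mem = shift_power_mem[OF True, of n]
      show ?thesis
        unfolding T_power[OF True]
        using Q_le[OF f True mem exp_le[OF N(1)[OF n] Q_pos[OF True mem] N(2)[OF n True]]]
          Q_le[OF f mem True exp_le[OF N(1)[OF n] Q_pos[OF mem True] N(3)[OF n True]]] ..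
    next
      case False
      then have Tn: "(T ^^ n) f y = 0" using N(1)[OF n] by (cases n) (simp_all add: T_def)
      have fy: "f y = 0" using harmonic_outside[OF f False] .
      show ?thesis unfolding Tn fy by simp
    qed
    then show ?thesis by blast
  qed
  \<comment> \<open>\<open>h\<close> is constrained only on \<open>E\<close>; its extension by 0 is
    a fixed point of \<open>step E p\<close> on the whole type.\<close>
  define f where "f y = (if y \<in> E then ennreal (h y) else 0)" for y
  let ?h = "\<lambda>y. ennreal (h y)"
  define a where "a y = (if y \<in> E then shift_diff_op G E p u ?h y else 0)" for y
  have f: "f \<in> H"
  proof -
    have "step E p f y = step E p ?h y" for y
      by (intro antisym step_mono) (auto simp: f_def)
    then have "step E p f y = f y" for y
      using assms(12) by (auto simp: harmonic_def step_def f_def)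
    then show ?thesis by (auto simp: H_def f_def)
  qed
  have "shift_diff_op G E p u f y = shift_diff_op G E p u ?h y" for y
    unfolding shift_diff_op_def by (intro nn_integral_cong) (simp add: f_def)
  then have "a = (\<lambda>y. if y \<in> E then shift_diff_op G E p u f y else 0)"
    by (simp add: a_def fun_eq_iff)
  then have Tf: "T f = (\<lambda>y. step E p (T f) y + a y)"
    by (simp only:) (rule T_eq[OF f])
  \<comment> \<open>Repeated substitution of the Poisson equation \<open>Tf\<close> into
    itself.\<close>
  have iterate: "T f y = (step E p ^^ k) (T f) y + (\<Sum>i<k. (step E p ^^ i) a y)" for k y
  proof (induction k)
    case (Suc k)
    have "(step E p ^^ k) (T f) y = (step E p ^^ k) (step E p (T f)) y + (step E p ^^ k) a y"
      by (subst Tf) (rule fun_cong[OF P_power_add])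
    then show ?case using Suc by (simp add: funpow_swap1 add_ac)
  qed simp
  have green: "green_op E M X \<phi> x = (\<Sum>t. (step E p ^^ t) \<phi> x)" for \<phi>
  proof -
    interpret markov_from "M x" E p X x by (rule chain[OF x])
    show ?thesis
      unfolding green_op_def green_def nn_integral_prob_X[symmetric]
      by (simp add: nn_integral_suminf flip: ennreal_suminf_multc)
  qed
  have "green_op E M X a x = green_op E M X (shift_diff_op G E p u ?h) x"
    unfolding green_op_def by (intro nn_integral_cong) (simp add: a_def)
  then have "(\<lambda>k. \<Sum>i<k. (step E p ^^ i) a x) \<longlonglongrightarrow> green_op E M X (shift_diff_op G E p u ?h) x"
    using summable_LIMSEQ[of "\<lambda>t. (step E p ^^ t) a x"] by (simp add: green summableI)
  \<comment> \<open>The partial sums converge to the Green term and the harmonic remainder to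
    \<open>f x\<close>, while the left side of \<open>iterate\<close> does not depend on
    \<open>k\<close>.\<close>
  then have "(\<lambda>k. (step E p ^^ k) (T f) x + (\<Sum>i<k. (step E p ^^ i) a x))
      \<longlonglongrightarrow> f x + green_op E M X (shift_diff_op G E p u ?h) x"
    by (intro tendsto_add P_power_T_tendsto growth f)
  then have "(\<lambda>k::nat. T f x) \<longlonglongrightarrow> f x + green_op E M X (shift_diff_op G E p u ?h) x"
    by (simp only: iterate[symmetric])
  then have "T f x = f x + green_op E M X (shift_diff_op G E p u ?h) x"
    by (simp add: tendsto_const_iff LIMSEQ_const_iff)
  then show "ennreal (h (x \<otimes>\<^bsub>G\<^esub> u)) = ennreal (h x) + green_op E M X (shift_diff_op G E p u ?h) x"
    using x shift_mem[OF x] by (simp add: T_def f_def)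
qed

end
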